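(* Let $K$ be a Cantor set and let $k\in\mathbb{N}$, $k\ge 1$. For any $k$-tuple $(x_1,\dots,x_k)\in K^k$ the subgroup $$\mathrm{Homeo}(K)_{[(x_1,\dots,x_k)]}=\{g\in\mathrm{Homeo}(K) : g \text{ fixes a neighborhood of } x_i \text{ pointwise, for } 1\le i\le k\}$$ of $\mathrm{Homeo}(K)$ is binate, so in particular boundedly acyclic.
   Context: A Cantor set is a metric space which is compact, totally disconnected and perfect (has no isolated points). $\mathrm{Homeo}(K)$ is the group of all homeomorphisms $K\to K$. A group $\Gamma$ is binate if for every finitely generated subgroup $H\le\Gamma$ there exist a homomorphism $\phi:H\to\Gamma$ and an element $\gamma\in\Gamma$ such that $h=[\gamma,\phi(h)]=\gamma^{-1}\phi(h)^{-1}\gamma\phi(h)$ for all $h\in H$. A group $\Gamma$ (always discrete) is boundedly acyclic if $H_b^n(\Gamma;\mathbb{R})=0$ for all $n\ge1$. Here $C_b^n(\Gamma;\mathbb{R})$ is the space of bounded functions $f:\Gamma^{n+1}\to\mathbb{R}$, with $\Gamma$-action $(g\cdot f)(g_0,\dots,g_n)=f(g^{-1}g_0,\dots,g^{-1}g_n)$ and coboundary $\delta^n f(g_0,\dots,g_{n+1})=\sum_{i=0}^{n+1}(-1)^i f(g_0,\dots,\widehat{g_i},\dots,g_{n+1})$, and $H_b^n(\Gamma;\mathbb{R})$ is the $n$-th cohomology of the complex $(C_b^\bullet(\Gamma;\mathbb{R})^\Gamma,\delta^\bullet)$. *)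

theory Defs
  imports "HOL-Analysis.Analysis" "HOL-Algebra.Algebra"
begin

definition totally_disconnected :: "'a::topological_space set \<Rightarrow> bool"
  where "totally_disconnected S \<longleftrightarrow> (\<forall>x\<in>S. connected_component_set S x = {x})"

definition cantor_set :: "'a::metric_space set \<Rightarrow> bool"
  where "cantor_set K \<longleftrightarrow>
    compact K \<and> totally_disconnected K \<and> (\<forall>x\<in>K. \<not> x isolated_in K)"

text \<open>As in \<^const>\<open>Bij\<close>, self-maps of \<open>K\<close> are represented by extensional functions,
  so that two of them are equal iff they agree on \<open>K\<close>.\<close>

definition homeo_group :: "'a::topological_space set \<Rightarrow> ('a \<Rightarrow> 'a) monoid"
  where "homeo_group K =
    (BijGroup K)\<lparr>carrier := {f \<in> extensional K. \<exists>g. homeomorphism K K f g}\<rparr>"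

definition germ_stabilizer :: "'a::topological_space set \<Rightarrow> nat \<Rightarrow> (nat \<Rightarrow> 'a) \<Rightarrow> ('a \<Rightarrow> 'a) set"
  where "germ_stabilizer K k x = {g \<in> carrier (homeo_group K).
    \<forall>i\<in>{1..k}. \<exists>U. openin (top_of_set K) U \<and> x i \<in> U \<and> (\<forall>y\<in>U. g y = y)}"

definition finitely_generated_subgroup :: "'a set \<Rightarrow> ('a, 'b) monoid_scheme \<Rightarrow> bool"
  where "finitely_generated_subgroup H G \<longleftrightarrow>
    subgroup H G \<and> (\<exists>S. finite S \<and> S \<subseteq> carrier G \<and> H = generate G S)"

definition binate :: "('a, 'b) monoid_scheme \<Rightarrow> bool"
  where "binate G \<longleftrightarrow> group G \<and>
    (\<forall>H. finitely_generated_subgroup H G \<longrightarrow>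
      (\<exists>\<phi> \<in> hom (G\<lparr>carrier := H\<rparr>) G. \<exists>\<gamma> \<in> carrier G. \<forall>h\<in>H.
        h = inv\<^bsub>G\<^esub> \<gamma> \<otimes>\<^bsub>G\<^esub> inv\<^bsub>G\<^esub> (\<phi> h) \<otimes>\<^bsub>G\<^esub> \<gamma> \<otimes>\<^bsub>G\<^esub> \<phi> h))"

text \<open>Elements of the power \<open>G\<^sup>m\<close> are lists of length \<open>m\<close>; cochains are extensional
  functions on such lists, and a cochain of degree \<open>n\<close> takes \<open>n + 1\<close> arguments.\<close>

definition tuples :: "('a, 'b) monoid_scheme \<Rightarrow> nat \<Rightarrow> 'a list set"
  where "tuples G m = {gs. length gs = m \<and> set gs \<subseteq> carrier G}"

definition bounded_cochains :: "('a, 'b) monoid_scheme \<Rightarrow> nat \<Rightarrow> ('a list \<Rightarrow> real) set"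
  where "bounded_cochains G n =
    {f \<in> extensional (tuples G (n + 1)). bounded (f ` tuples G (n + 1))}"

definition cochain_action ::
    "('a, 'b) monoid_scheme \<Rightarrow> nat \<Rightarrow> 'a \<Rightarrow> ('a list \<Rightarrow> real) \<Rightarrow> 'a list \<Rightarrow> real"
  where "cochain_action G n g f =
    (\<lambda>gs \<in> tuples G (n + 1). f (map (\<lambda>x. inv\<^bsub>G\<^esub> g \<otimes>\<^bsub>G\<^esub> x) gs))"

definition invariant_bounded_cochains ::
    "('a, 'b) monoid_scheme \<Rightarrow> nat \<Rightarrow> ('a list \<Rightarrow> real) set"
  where "invariant_bounded_cochains G n =
    {f \<in> bounded_cochains G n. \<forall>g \<in> carrier G. cochain_action G n g f = f}"

definition zero_cochain :: "('a, 'b) monoid_scheme \<Rightarrow> nat \<Rightarrow> 'a list \<Rightarrow> real"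
  where "zero_cochain G n = (\<lambda>gs \<in> tuples G (n + 1). 0)"

text \<open>\<open>coboundary G n\<close> goes from degree \<open>n\<close> to degree \<open>n + 1\<close>;
  \<open>take i gs @ drop (Suc i) gs\<close> omits the entry of \<open>gs\<close> with index \<open>i\<close>.\<close>

definition coboundary ::
    "('a, 'b) monoid_scheme \<Rightarrow> nat \<Rightarrow> ('a list \<Rightarrow> real) \<Rightarrow> 'a list \<Rightarrow> real"
  where "coboundary G n f =
    (\<lambda>gs \<in> tuples G (n + 2). \<Sum>i\<le>n + 1. (-1) ^ i * f (take i gs @ drop (Suc i) gs))"

definition bounded_cocycles :: "('a, 'b) monoid_scheme \<Rightarrow> nat \<Rightarrow> ('a list \<Rightarrow> real) monoid"
  where "bounded_cocycles G n =
    \<lparr>carrier = {f \<in> invariant_bounded_cochains G n. coboundary G n f = zero_cochain G (n + 1)},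
     mult = \<lambda>f f'. \<lambda>gs \<in> tuples G (n + 1). f gs + f' gs,
     one = zero_cochain G n\<rparr>"

definition bounded_coboundaries :: "('a, 'b) monoid_scheme \<Rightarrow> nat \<Rightarrow> ('a list \<Rightarrow> real) set"
  where "bounded_coboundaries G n =
    (case n of
       0 \<Rightarrow> {zero_cochain G 0}
     | Suc m \<Rightarrow> coboundary G m ` invariant_bounded_cochains G m)"

text \<open>The additive group underlying the real vector space \<open>H\<^sub>b\<^sup>n(G; \<real>)\<close>. The scalar
  multiplication plays no role in its vanishing.\<close>

definition bounded_cohomology ::
    "('a, 'b) monoid_scheme \<Rightarrow> nat \<Rightarrow> ('a list \<Rightarrow> real) set monoid"
  where "bounded_cohomology G n = bounded_cocycles G n Mod bounded_coboundaries G n"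

definition boundedly_acyclic :: "('a, 'b) monoid_scheme \<Rightarrow> bool"
  where "boundedly_acyclic G \<longleftrightarrow>
    group G \<and> (\<forall>n\<ge>1. trivial_group (bounded_cohomology G n))"

end

theory Submission
  imports Defs
begin

text \<open>
  Binateness is a Mather swindle. A finitely generated subgroup \<open>H\<close> fixes a neighbourhood of the
  points \<open>x i\<close> pointwise, so it is supported in a clopen set that has a bi-infinite sequence of disjoint
  copies which accumulate only at one point \<open>p\<close>, different from all \<open>x i\<close>; the copies exist because any two
  nonempty Cantor sets are homeomorphic.

  A binate group is boundedly acyclic by induction on the degree \<open>n\<close>. If \<open>h = [\<gamma>, \<phi>(h)]\<close> on \<open>H\<close>, then
  \<open>\<phi>(h) = \<phi>'(h) h\<close> for the conjugate \<open>\<phi>' = \<gamma>\<^sup>-\<^sup>1 \<phi> \<gamma>\<close>, and \<open>\<phi>'(g)\<close> commutes with \<open>h\<close>, so \<open>(g, h) \<mapsto> \<phi>'(g) h\<close>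
  is a homomorphism on \<open>H \<times> H\<close>. By a Kuenneth argument, in which the cross terms vanish by the induction
  hypothesis, every class of degree \<open>n\<close> satisfies \<open>\<phi>\<^sup>* = \<phi>'\<^sup>* + res\<close>, where \<open>res\<close> is the restriction to \<open>H\<close>.
  Conjugation acts trivially, hence \<open>res = 0\<close>. The passage from \<open>H\<close> to the whole group is made by a
  limit along an ultrafilter on the finite subsets of the group, before the Kuenneth argument is
  applied.
\<close>

subsection \<open>Cochains on lists\<close>

text \<open>Bounded cohomology does not commute with directed unions, so it would not suffice to
  treat the subgroups \<open>H\<close> one by one; and the induction hypothesis concerns the whole
  group, since finitely generated subgroups need not be boundedly acyclic. Hence the Kuenneth
  argument has to run on two copies of the whole group. The homomorphisms for different
  \<open>H\<close> are not compatible, but each identity between finitely many elements holds for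
  all large finite sets, and bounded families have limits along an ultrafilter. So the limit of the
  pulled back cocycles is invariant under both factors, although there is no limit homomorphism. All
  homotopies come from coning because such formulas are natural, which makes the primitives
  invariant, and have norms that depend on the degree only, which survives the limit and gives the
  uniform bound in \<open>bc_vanishes\<close>. In the swindle the blocks are indexed by integers
  because the shift has to be invertible; with a one-sided sequence it would not be a
  homeomorphism.\<close>

text \<open>The alternating sum of \<open>c\<close> over the lists obtained by omitting one entry, see
  \<open>codiff_eq_sum\<close>. The recursion says that prepending \<open>v\<close> is a contracting homotopy; every chain
  homotopy below is built by such coning.\<close>

fun codiff :: "('a list \<Rightarrow> real) \<Rightarrow> 'a list \<Rightarrow> real" where
  "codiff c [] = 0"
| "codiff c (v # xs) = c xs - codiff (\<lambda>ys. c (v # ys)) xs"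

text \<open>Faces only use entries of \<open>xs\<close>. This allows comparing cochains that are
  controlled only on lists of carrier elements.\<close>

lemma codiff_cong_set:
  assumes "\<And>ys. set ys \<subseteq> set xs \<Longrightarrow> Suc (length ys) = length xs \<Longrightarrow> c ys = d ys"
  shows "codiff c xs = codiff d xs"
  using assms
proof (induction xs arbitrary: c d)
  case (Cons v xs)
  have "codiff (\<lambda>ys. c (v # ys)) xs = codiff (\<lambda>ys. d (v # ys)) xs"
    by (rule Cons.IH, rule Cons.prems) auto
  with Cons.prems show ?case by auto
qed simp

lemma codiff_cong:
  assumes "\<And>ys. Suc (length ys) = length xs \<Longrightarrow> c ys = d ys"
  shows "codiff c xs = codiff d xs"
  using assms by (rule codiff_cong_set)

lemma codiff_add: "codiff (\<lambda>ys. c ys + d ys) xs = codiff c xs + codiff d xs"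
  by (induction xs arbitrary: c d) (auto simp: algebra_simps)

lemma codiff_diff: "codiff (\<lambda>ys. c ys - d ys) xs = codiff c xs - codiff d xs"
  by (induction xs arbitrary: c d) (auto simp: algebra_simps)

lemma codiff_cmult: "codiff (\<lambda>ys. r * c ys) xs = r * codiff c xs"
  by (induction xs arbitrary: c) (auto simp: algebra_simps)

lemma codiff_zero [simp]: "codiff (\<lambda>ys. 0) xs = 0"
  by (induction xs) auto

lemma codiff_map: "codiff c (map f xs) = codiff (\<lambda>ys. c (map f ys)) xs"
  by (induction xs arbitrary: c) auto

text \<open>By the cone formula two copies of \<open>codiff c xs\<close> cancel; what remains is the
  claim for \<open>xs\<close> and the cochain \<open>\<lambda>ys. c (v # ys)\<close>.\<close>

lemma codiff_codiff: "codiff (codiff c) xs = 0"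
proof (induction xs arbitrary: c)
  case (Cons v xs)
  show ?case by (simp add: codiff_diff Cons)
qed simp

lemma codiff_commute:
  "codiff (\<lambda>ys. codiff (\<lambda>zs. f ys zs) hs) gs = codiff (\<lambda>zs. codiff (\<lambda>ys. f ys zs) gs) hs"
  by (induction gs arbitrary: f) (auto simp: codiff_diff)

lemma abs_codiff_le:
  assumes "\<And>ys. Suc (length ys) = length xs \<Longrightarrow> \<bar>c ys\<bar> \<le> B"
  shows "\<bar>codiff c xs\<bar> \<le> real (length xs) * B"
  using assms
proof (induction xs arbitrary: c)
  case (Cons v xs)
  have "\<bar>codiff (\<lambda>ys. c (v # ys)) xs\<bar> \<le> real (length xs) * B"
    by (rule Cons.IH) (use Cons.prems in auto)
  moreover have "\<bar>c xs\<bar> \<le> B" using Cons.prems by auto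
  ultimately show ?case by (auto simp: algebra_simps)
qed simp

lemma codiff_eq_sum:
  "codiff c xs = (\<Sum>i<length xs. (-1) ^ i * c (take i xs @ drop (Suc i) xs))"
proof (induction xs arbitrary: c)
  case (Cons v xs)
  show ?case
    by (simp add: Cons sum.lessThan_Suc_shift sum_negf del: sum.lessThan_Suc)
qed simp

text \<open>Without augmentation: a singleton list has no faces. A pair of nonempty lists represents
  a product of two simplices, with the boundary \<open>\<partial>\<otimes>1 \<plusminus> 1\<otimes>\<partial>\<close> dual to \<open>tcodiff\<close>.\<close>

definition rcodiff :: "('a list \<Rightarrow> real) \<Rightarrow> 'a list \<Rightarrow> real" where
  "rcodiff c xs = (if length xs \<le> 1 then 0 else codiff c xs)"

definition tcodiff :: "('a list \<Rightarrow> 'b list \<Rightarrow> real) \<Rightarrow> 'a list \<Rightarrow> 'b list \<Rightarrow> real" where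
  "tcodiff f gs hs =
    rcodiff (\<lambda>ys. f ys hs) gs + (-1) ^ (length gs - 1) * rcodiff (f gs) hs"

lemma tcodiff_cong:
  assumes "\<And>ys zs. ys \<noteq> [] \<Longrightarrow> zs \<noteq> [] \<Longrightarrow> Suc (length ys + length zs) = length gs + length hs \<Longrightarrow> f ys zs = f' ys zs"
    and "gs \<noteq> []" "hs \<noteq> []"
  shows "tcodiff f gs hs = tcodiff f' gs hs"
proof -
  have "codiff (\<lambda>ys. f ys hs) gs = codiff (\<lambda>ys. f' ys hs) gs" if "length gs > 1"
    by (rule codiff_cong) (use assms that in \<open>auto intro!: assms(1)\<close>)
  moreover have "codiff (f gs) hs = codiff (f' gs) hs" if "length hs > 1"
    by (rule codiff_cong) (use assms that in \<open>auto intro!: assms(1)\<close>)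
  ultimately show ?thesis by (auto simp: tcodiff_def rcodiff_def)
qed

lemma tcodiff_diff:
  "tcodiff (\<lambda>ys zs. f ys zs - f' ys zs) gs hs = tcodiff f gs hs - tcodiff f' gs hs"
  by (simp add: tcodiff_def rcodiff_def codiff_diff algebra_simps)

lemma tcodiff_add:
  "tcodiff (\<lambda>ys zs. f ys zs + f' ys zs) gs hs = tcodiff f gs hs + tcodiff f' gs hs"
  by (simp add: tcodiff_def rcodiff_def codiff_add algebra_simps)

lemma tcodiff_zero [simp]: "tcodiff (\<lambda>ys zs. 0) gs hs = 0"
  by (simp add: tcodiff_def rcodiff_def)

lemma tcodiff_map:
  "tcodiff f (map a gs) (map b hs) = tcodiff (\<lambda>ys zs. f (map a ys) (map b zs)) gs hs"
  by (simp add: tcodiff_def rcodiff_def codiff_map)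

text \<open>Lists of length at most two are separate: there the inner \<open>rcodiff\<close> is
  already zero on every face, whereas \<open>codiff\<close> would go on to the empty list.\<close>

lemma rcodiff_rcodiff: "rcodiff (rcodiff c) xs = 0"
proof (cases "length xs \<le> 2")
  case True
  have "codiff (rcodiff c) xs = codiff (\<lambda>_. 0) xs"
    by (rule codiff_cong) (use True in \<open>auto simp: rcodiff_def\<close>)
  then show ?thesis by (simp add: rcodiff_def)
next
  case False
  have "codiff (rcodiff c) xs = codiff (codiff c) xs"
    by (rule codiff_cong) (use False in \<open>auto simp: rcodiff_def\<close>)
  then show ?thesis by (simp add: rcodiff_def codiff_codiff)
qed

lemma rcodiff_commute:
  "rcodiff (\<lambda>ys. rcodiff (\<lambda>zs. f ys zs) hs) gs = rcodiff (\<lambda>zs. rcodiff (\<lambda>ys. f ys zs) gs) hs"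
  by (simp add: rcodiff_def codiff_commute[of f hs gs])

lemma rcodiff_add: "rcodiff (\<lambda>ys. c ys + d ys) xs = rcodiff c xs + rcodiff d xs"
  by (simp add: rcodiff_def codiff_add)

lemma rcodiff_cmult: "rcodiff (\<lambda>ys. r * c ys) xs = r * rcodiff c xs"
  by (simp add: rcodiff_def codiff_cmult)

lemma rcodiff_cong:
  assumes "\<And>ys. Suc (length ys) = length xs \<Longrightarrow> c ys = d ys"
  shows "rcodiff c xs = rcodiff d xs"
  using codiff_cong[of xs c d] assms by (simp add: rcodiff_def)

lemma rcodiff_short: "length xs \<le> 1 \<Longrightarrow> rcodiff c xs = 0"
  by (simp add: rcodiff_def)

text \<open>The two mixed terms are the same iterated difference with opposite signs, because
  omitting an entry of \<open>gs\<close> lowers the exponent in \<open>tcodiff\<close> by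
  one.\<close>

lemma tcodiff_tcodiff: "tcodiff (tcodiff f) gs hs = 0"
proof (cases "length gs \<le> 1")
  case True
  then show ?thesis
    by (simp add: tcodiff_def[abs_def] rcodiff_short[of gs] rcodiff_cmult rcodiff_rcodiff)
next
  case False
  let ?X = "rcodiff (\<lambda>ys. rcodiff (f ys) hs) gs"
  have "rcodiff (\<lambda>ys. (-1) ^ (length ys - 1) * rcodiff (f ys) hs) gs
      = rcodiff (\<lambda>ys. (-1) ^ (length gs - 2) * rcodiff (f ys) hs) gs"
    by (rule rcodiff_cong) (metis Suc_1 diff_Suc_Suc diff_Suc_1 diff_Suc_eq_diff_pred)
  then have 1: "rcodiff (\<lambda>ys. tcodiff f ys hs) gs = (-1) ^ (length gs - 2) * ?X"
    by (simp add: tcodiff_def rcodiff_add rcodiff_cmult rcodiff_rcodiff)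
  have 2: "rcodiff (tcodiff f gs) hs = ?X"
    by (simp add: tcodiff_def[abs_def] rcodiff_add rcodiff_cmult rcodiff_rcodiff rcodiff_commute[of f hs gs])
  obtain m where "length gs = Suc (Suc m)" using False by (cases "length gs"; cases "length gs - 1") auto
  then show ?thesis using 1 2 by (simp add: tcodiff_def[of "tcodiff f"])
qed

lemma abs_tcodiff_le:
  assumes "\<And>ys zs. ys \<noteq> [] \<Longrightarrow> zs \<noteq> [] \<Longrightarrow> Suc (length ys + length zs) = length gs + length hs \<Longrightarrow> \<bar>f ys zs\<bar> \<le> B"
    and "gs \<noteq> []" "hs \<noteq> []" "B \<ge> 0"
  shows "\<bar>tcodiff f gs hs\<bar> \<le> real (length gs + length hs) * B"
proof -
  have "\<bar>codiff (\<lambda>ys. f ys hs) gs\<bar> \<le> real (length gs) * B" if "length gs > 1"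
    by (rule abs_codiff_le) (use assms that in \<open>auto intro!: assms(1)\<close>)
  then have 1: "\<bar>rcodiff (\<lambda>ys. f ys hs) gs\<bar> \<le> real (length gs) * B"
    using assms(4) by (auto simp: rcodiff_def)
  have "\<bar>codiff (f gs) hs\<bar> \<le> real (length hs) * B" if "length hs > 1"
    by (rule abs_codiff_le) (use assms that in \<open>auto intro!: assms(1)\<close>)
  then have 2: "\<bar>rcodiff (f gs) hs\<bar> \<le> real (length hs) * B"
    using assms(4) by (auto simp: rcodiff_def)
  have "\<bar>tcodiff f gs hs\<bar> \<le> \<bar>rcodiff (\<lambda>ys. f ys hs) gs\<bar> + \<bar>(-1) ^ (length gs - 1) * rcodiff (f gs) hs\<bar>"
    unfolding tcodiff_def by (rule abs_triangle_ineq)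
  also have "\<dots> = \<bar>rcodiff (\<lambda>ys. f ys hs) gs\<bar> + \<bar>rcodiff (f gs) hs\<bar>"
    by (simp add: abs_mult)
  finally show ?thesis using 1 2 by (simp add: algebra_simps)
qed

text \<open>The Eilenberg--Zilber map. Cells in which one factor is a point are simplices already; all
  others are triangulated by coning the triangulated boundary from the first vertex.\<close>

definition edge_path :: "'a list \<Rightarrow> 'b list \<Rightarrow> ('a \<times> 'b) list" where
  "edge_path gs hs = (if length gs \<le> 1 then map (Pair (hd gs)) hs else map (\<lambda>g. (g, hd hs)) gs)"

primrec ez :: "nat \<Rightarrow> (('a \<times> 'b) list \<Rightarrow> real) \<Rightarrow> 'a list \<Rightarrow> 'b list \<Rightarrow> real" where
  "ez 0 c = (\<lambda>gs hs. c (edge_path gs hs))"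
| "ez (Suc m) c = (\<lambda>gs hs. if length gs \<le> 1 \<or> length hs \<le> 1 then c (edge_path gs hs)
     else tcodiff (ez m (\<lambda>xs. c ((hd gs, hd hs) # xs))) gs hs)"

lemma ez_diff: "ez m (\<lambda>xs. c xs - d xs) gs hs = ez m c gs hs - ez m d gs hs"
proof (induction m arbitrary: c d gs hs)
  case (Suc m)
  show ?case by (simp add: Suc[abs_def] tcodiff_diff)
qed simp

lemma ez_edge: "length gs \<le> 1 \<or> length hs \<le> 1 \<Longrightarrow> ez m c gs hs = c (edge_path gs hs)"
  by (cases m) auto

text \<open>The chain map property. The index of \<open>ez\<close> is the dimension of the cell,
  that is \<open>length gs + length hs - 2\<close>; it drops by one on faces.\<close>

lemma ez_codiff:
  assumes "gs \<noteq> []" "hs \<noteq> []" "length gs + length hs = m + 3"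
  shows "ez (Suc m) (codiff c) gs hs = tcodiff (ez m c) gs hs"
  using assms
proof (induction m arbitrary: c gs hs)
  case 0
  then have "length gs \<ge> 1" "length hs \<ge> 1" by (simp_all add: Suc_le_eq)
  with 0 consider "length gs = 1" "length hs = 2" | "length gs = 2" "length hs = 1"
    by linarith
  then show ?case
    by cases (auto simp: edge_path_def tcodiff_def rcodiff_def length_Suc_conv numeral_eq_Suc)
next
  case (Suc m)
  consider "length gs = 1" | "length hs = 1" | "length gs \<ge> 2" "length hs \<ge> 2"
  proof -
    have "length gs \<ge> 1" "length hs \<ge> 1" using Suc.prems by (simp_all add: Suc_le_eq)
    then show ?thesis using that by linarith
  qed
  then show ?case
  proof cases
    case 1
    then have "codiff (\<lambda>ys. c (edge_path gs ys)) hs = codiff (ez (Suc m) c gs) hs"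
      by (intro codiff_cong) (simp add: ez_edge del: ez.simps)
    with 1 Suc.prems show ?thesis
      by (simp add: ez_edge tcodiff_def rcodiff_def del: ez.simps)
        (simp add: edge_path_def codiff_map)
  next
    case 2
    have "codiff (\<lambda>ys. c (map (\<lambda>g. (g, hd hs)) ys)) gs = codiff (\<lambda>ys. ez (Suc m) c ys hs) gs"
    proof (rule codiff_cong)
      fix ys :: "'a list" assume "Suc (length ys) = length gs"
      then have "length ys > 1" using 2 Suc.prems by simp
      then show "c (map (\<lambda>g. (g, hd hs)) ys) = ez (Suc m) c ys hs"
        using 2 by (simp add: ez_edge edge_path_def del: ez.simps)
    qed
    with 2 Suc.prems show ?thesis
      by (simp add: ez_edge tcodiff_def rcodiff_def edge_path_def codiff_map del: ez.simps)
  next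
    case 3
    let ?v = "(hd gs, hd hs)" let ?c = "\<lambda>xs. c (?v # xs)"
    have "ez (Suc (Suc m)) (codiff c) gs hs = tcodiff (ez (Suc m) (\<lambda>xs. c xs - codiff ?c xs)) gs hs"
      using 3 by simp
    also have "\<dots> = tcodiff (ez (Suc m) c) gs hs - tcodiff (ez (Suc m) (codiff ?c)) gs hs"
      by (simp add: ez_diff[abs_def] tcodiff_diff del: ez.simps)
    \<comment> \<open>The cone formula leaves the coned term as an error. By the induction
      hypothesis on each face it is a double coboundary, hence zero.\<close>
    also have "tcodiff (ez (Suc m) (codiff ?c)) gs hs = tcodiff (tcodiff (ez m ?c)) gs hs"
      by (rule tcodiff_cong) (use Suc.prems in \<open>auto intro!: Suc.IH simp del: ez.simps\<close>)
    finally show ?thesis by (simp add: tcodiff_tcodiff del: ez.simps)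
  qed
qed

text \<open>Naturality: the cone vertex consists of the heads of the two lists, so it moves along
  with them. It transfers the invariance of a cocycle to its triangulated form.\<close>

lemma ez_map:
  assumes "gs \<noteq> []" "hs \<noteq> []"
  shows "ez m c (map a gs) (map b hs) = ez m (\<lambda>xs. c (map (map_prod a b) xs)) gs hs"
  using assms
proof (induction m arbitrary: c gs hs)
  case 0
  then show ?case by (auto simp: edge_path_def hd_map comp_def)
next
  case (Suc m)
  show ?case
  proof (cases "length gs \<le> 1 \<or> length hs \<le> 1")
    case True
    then show ?thesis using Suc.prems by (auto simp: edge_path_def hd_map comp_def)
  next
    case False
    have "ez (Suc m) c (map a gs) (map b hs)
       = tcodiff (\<lambda>ys zs. ez m (\<lambda>xs. c ((a (hd gs), b (hd hs)) # xs)) (map a ys) (map b zs)) gs hs"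
      using False Suc.prems by (simp add: hd_map tcodiff_map)
    also have "\<dots> = tcodiff (ez m (\<lambda>xs. c ((a (hd gs), b (hd hs)) # map (map_prod a b) xs))) gs hs"
      by (rule tcodiff_cong) (use Suc in auto)
    finally show ?thesis using False by simp
  qed
qed

text \<open>Operator norm bound of \<open>ez m\<close>: a cell of dimension \<open>m + 1\<close> has
  \<open>m + 3\<close> entries in its two lists, hence at most that many faces.\<close>

primrec ez_bound :: "nat \<Rightarrow> real" where
  "ez_bound 0 = 1"
| "ez_bound (Suc m) = 1 + real (m + 3) * ez_bound m"

lemma ez_bound_pos: "ez_bound m > 0"
  by (induction m) (auto intro!: add_pos_nonneg)

lemma abs_ez_le:
  assumes "\<And>xs. \<bar>c xs\<bar> \<le> B" "gs \<noteq> []" "hs \<noteq> []" "length gs + length hs = m + 2"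
  shows "\<bar>ez m c gs hs\<bar> \<le> ez_bound m * B"
  using assms
proof (induction m arbitrary: c gs hs)
  case (Suc m)
  have B0: "0 \<le> B" using Suc.prems(1)[of "[]"] by linarith
  have N0: "0 \<le> ez_bound m" using ez_bound_pos[of m] by simp
  show ?case
  proof (cases "length gs \<le> 1 \<or> length hs \<le> 1")
    case True
    have "\<bar>ez (Suc m) c gs hs\<bar> \<le> 1 * B" using Suc.prems True by simp
    also have "\<dots> \<le> ez_bound (Suc m) * B" by (rule mult_right_mono) (use N0 B0 in auto)
    finally show ?thesis .
  next
    case False
    have "\<bar>tcodiff (ez m (\<lambda>xs. c ((hd gs, hd hs) # xs))) gs hs\<bar> \<le> real (length gs + length hs) * (ez_bound m * B)"
      by (rule abs_tcodiff_le) (use N0 B0 Suc.prems in \<open>auto intro!: Suc.IH\<close>)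
    also have "\<dots> \<le> ez_bound (Suc m) * B" using Suc.prems B0 by (simp add: algebra_simps)
    finally show ?thesis using False by simp
  qed
qed simp

text \<open>The Alexander--Whitney diagonal: the sum over all ways to cut the list at a vertex, which
  belongs to both parts.\<close>

primrec aw :: "('a list \<Rightarrow> 'a list \<Rightarrow> real) \<Rightarrow> 'a list \<Rightarrow> real" where
  "aw f [] = 0"
| "aw f (x # xs) = f [x] (x # xs) + aw (\<lambda>ys. f (x # ys)) xs"

lemma aw_cong:
  assumes "\<And>ys zs. ys \<noteq> [] \<Longrightarrow> zs \<noteq> [] \<Longrightarrow> length ys + length zs = Suc (length xs) \<Longrightarrow> f ys zs = f' ys zs"
  shows "aw f xs = aw f' xs"
  using assms
proof (induction xs arbitrary: f f')
  case (Cons x xs)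
  have "aw (\<lambda>ys. f (x # ys)) xs = aw (\<lambda>ys. f' (x # ys)) xs"
    by (rule Cons.IH) (use Cons.prems in auto)
  with Cons.prems show ?case by simp
qed simp

lemma aw_diff: "aw (\<lambda>ys zs. f ys zs - f' ys zs) xs = aw f xs - aw f' xs"
  by (induction xs arbitrary: f f') (auto simp: algebra_simps)

lemma aw_map: "aw f (map a xs) = aw (\<lambda>ys zs. f (map a ys) (map a zs)) xs"
  by (induction xs arbitrary: f) auto

lemma abs_aw_le:
  assumes "\<And>ys zs. ys \<noteq> [] \<Longrightarrow> zs \<noteq> [] \<Longrightarrow> length ys + length zs = Suc (length xs) \<Longrightarrow> \<bar>f ys zs\<bar> \<le> B"
  shows "\<bar>aw f xs\<bar> \<le> real (length xs) * B"
  using assms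
proof (induction xs arbitrary: f)
  case (Cons x xs)
  have "\<bar>aw (\<lambda>ys. f (x # ys)) xs\<bar> \<le> real (length xs) * B"
    by (rule Cons.IH) (use Cons.prems in auto)
  moreover have "\<bar>f [x] (x # xs)\<bar> \<le> B" by (rule Cons.prems) auto
  ultimately show ?case by (auto simp: algebra_simps)
qed simp

text \<open>The chain map property. Omitting the cut vertex from the first part of one cut gives the
  same term, with opposite sign, as omitting it from the second part of the preceding cut.\<close>

lemma aw_tcodiff: "aw (tcodiff f) xs = codiff (aw f) xs"
proof (induction xs arbitrary: f)
  case (Cons x xs)
  show ?case
  proof (cases xs)
    case Nil
    then show ?thesis by (simp add: tcodiff_def rcodiff_def)
  next
    case (Cons x' xs')
    let ?f = "\<lambda>ys. f (x # ys)"
    \<comment> \<open>The face of \<open>[x, y]\<close> without \<open>y\<close>. It occurs in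
      \<open>tcodiff f\<close>, but not in \<open>tcodiff ?f\<close>, where the first variable
      \<open>[y]\<close> has no face. It cancels against the cut at \<open>x\<close>.\<close>
    let ?d = "\<lambda>ys zs. if length ys = 1 then f [x] zs else 0"
    have "tcodiff f (x # ys) zs = f ys zs - tcodiff ?f ys zs - ?d ys zs"
      if "ys \<noteq> []" for ys zs
    proof (cases ys)
      case (Cons y ys')
      then show ?thesis by (cases ys') (simp_all add: tcodiff_def rcodiff_def)
    qed (use that in simp)
    then have "aw (\<lambda>ys. tcodiff f (x # ys)) xs = aw (\<lambda>ys zs. f ys zs - tcodiff ?f ys zs - ?d ys zs) xs"
      by (intro aw_cong) auto
    also have "\<dots> = aw f xs - aw (tcodiff ?f) xs - aw ?d xs"
      by (simp only: aw_diff)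
    also have "aw ?d xs = f [x] xs"
    proof -
      have "aw (\<lambda>ys. ?d (x' # ys)) xs' = aw (\<lambda>ys zs. 0) xs'"
        by (rule aw_cong) auto
      moreover have "aw (\<lambda>ys zs. 0) zs = 0" for zs :: "'a list"
        by (induction zs) auto
      ultimately show ?thesis using Cons by simp
    qed
    finally have "aw (tcodiff f) (x # xs) =
      tcodiff f [x] (x # xs) + aw f xs - codiff (aw ?f) xs - f [x] xs"
      using Cons.IH by simp
    moreover have "tcodiff f [x] (x # xs) = f [x] xs - codiff (\<lambda>ys. f [x] (x # ys)) xs"
      using Cons by (simp add: tcodiff_def rcodiff_def)
    ultimately show ?thesis by (simp add: codiff_add)
  qed
qed simp

lemma aw_eq_last:
  assumes "\<And>ys zs. ys \<noteq> [] \<Longrightarrow> length zs \<ge> 2 \<Longrightarrow> length ys + length zs = Suc (length xs) \<Longrightarrow> f ys zs = 0"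
    and "xs \<noteq> []"
  shows "aw f xs = f xs [last xs]"
  using assms
proof (induction xs arbitrary: f)
  case (Cons x xs)
  show ?case
  proof (cases "xs = []")
    case False
    have "aw (\<lambda>ys. f (x # ys)) xs = f (x # xs) [last xs]"
      by (rule Cons.IH) (use Cons.prems False in auto)
    moreover have "f [x] (x # xs) = 0"
      by (rule Cons.prems) (use False in \<open>auto simp: Suc_le_eq\<close>)
    ultimately show ?thesis using False by simp
  qed simp
qed simp

text \<open>Only the cuts at the first and the last vertex have a part that is a point. A cocycle
  without mixed components is thereby reduced on the diagonal to its two factors.\<close>

lemma aw_eq_ends:
  assumes "\<And>ys zs. length ys \<ge> 2 \<Longrightarrow> length zs \<ge> 2 \<Longrightarrow> length ys + length zs = Suc (length xs) \<Longrightarrow> f ys zs = 0"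
    and "length xs \<ge> 2"
  shows "aw f xs = f [hd xs] xs + f xs [last xs]"
proof -
  obtain x xs' where xs: "xs = x # xs'" "xs' \<noteq> []"
    using assms(2) by (cases xs) (auto simp: Suc_le_length_iff numeral_2_eq_2)
  have "aw (\<lambda>ys. f (x # ys)) xs' = f (x # xs') [last xs']"
    by (rule aw_eq_last) (use assms(1) xs in \<open>auto simp: Suc_le_eq\<close>)
  then show ?thesis using xs by simp
qed

text \<open>A chain map that is dual to \<open>P\<close> and has zero augmentation is null-homotopic, by coning from
  the vertex \<open>v\<close> of the first entry.\<close>

primrec cone_htp ::
  "(('b list \<Rightarrow> real) \<Rightarrow> 'a list \<Rightarrow> real) \<Rightarrow> ('a \<Rightarrow> 'b) \<Rightarrow> nat \<Rightarrow> ('b list \<Rightarrow> real) \<Rightarrow> 'a list \<Rightarrow> real"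
  where
  "cone_htp P v 0 c = (\<lambda>xs. 0)"
| "cone_htp P v (Suc m) c = (\<lambda>xs. P (\<lambda>ys. c (v (hd xs) # ys)) xs
     - codiff (cone_htp P v m (\<lambda>ys. c (v (hd xs) # ys))) xs)"

lemma cone_htp_diff:
  assumes "\<And>c d xs. P (\<lambda>ys. c ys - d ys) xs = P c xs - P d xs"
  shows "cone_htp P v m (\<lambda>ys. c ys - d ys) xs = cone_htp P v m c xs - cone_htp P v m d xs"
proof (induction m arbitrary: c d xs)
  case (Suc m)
  show ?case by (simp add: Suc[abs_def] codiff_diff assms)
qed simp

lemma cone_htp_zero:
  assumes "\<And>c d xs. P (\<lambda>ys. c ys - d ys) xs = P c xs - P d xs"
  shows "cone_htp P v m (\<lambda>ys. 0) xs = 0"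
  using cone_htp_diff[of P v m "\<lambda>_. 0" "\<lambda>_. 0" xs] assms by simp

text \<open>In the induction the cone formula produces the error \<open>P (codiff ?c) xs\<close>,
  which the induction hypothesis on the faces reproduces with the opposite sign. If
  \<open>codiff c\<close> vanishes, the identity exhibits \<open>P c\<close> as a
  coboundary.\<close>

lemma cone_htp_codiff:
  assumes diff: "\<And>c d xs. P (\<lambda>ys. c ys - d ys) xs = P c xs - P d xs"
    and chain: "\<And>c xs. xs \<noteq> [] \<Longrightarrow> P (codiff c) xs = codiff (P c) xs"
    and aug: "\<And>c. P c [] = 0"
    and "length xs = Suc m"
  shows "cone_htp P v (Suc m) (codiff c) xs = P c xs - codiff (cone_htp P v m c) xs"
  using assms(4)
proof (induction m arbitrary: c xs)
  case 0
  then obtain x where "xs = [x]" by (auto simp: length_Suc_conv)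
  then show ?case by (simp add: diff chain aug)
next
  case (Suc m)
  let ?c = "\<lambda>ys. c (v (hd xs) # ys)"
  have "cone_htp P v (Suc (Suc m)) (codiff c) xs
     = P (\<lambda>ys. c ys - codiff ?c ys) xs - codiff (cone_htp P v (Suc m) (\<lambda>ys. c ys - codiff ?c ys)) xs"
    by (simp only: cone_htp.simps(2)[of P v "Suc m"] codiff.simps)
  also have "\<dots> = P c xs - P (codiff ?c) xs - codiff (cone_htp P v (Suc m) c) xs
      + codiff (cone_htp P v (Suc m) (codiff ?c)) xs"
    by (simp only: diff cone_htp_diff[OF diff, abs_def] codiff_diff)
  also have "codiff (cone_htp P v (Suc m) (codiff ?c)) xs
      = codiff (\<lambda>ys. P ?c ys - codiff (cone_htp P v m ?c) ys) xs"
    by (rule codiff_cong) (use Suc in \<open>auto simp del: cone_htp.simps\<close>)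
  also have "\<dots> = P (codiff ?c) xs"
    using Suc.prems by (subst chain) (auto simp: codiff_diff codiff_codiff)
  finally show ?case by simp
qed

text \<open>Naturality of the homotopy, with \<open>a\<close> acting on its simplices and
  \<open>b\<close> on those of \<open>c\<close>. This is how primitives inherit invariance.\<close>

lemma cone_htp_map:
  assumes P: "\<And>c xs. P c (map a xs) = P (\<lambda>ys. c (map b ys)) xs"
    and v: "\<And>x. v (a x) = b (v x)"
    and "length xs = m"
  shows "cone_htp P v m c (map a xs) = cone_htp P v m (\<lambda>ys. c (map b ys)) xs"
  using assms(3)
proof (induction m arbitrary: c xs)
  case (Suc m)
  then have "xs \<noteq> []" by auto
  let ?c = "\<lambda>ys. c (b (v (hd xs)) # ys)"
  have "codiff (\<lambda>ys. cone_htp P v m ?c (map a ys)) xs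
      = codiff (cone_htp P v m (\<lambda>ys. ?c (map b ys))) xs"
    by (rule codiff_cong) (use Suc in auto)
  with \<open>xs \<noteq> []\<close> show ?case by (simp add: hd_map v P codiff_map)
qed simp

text \<open>Here \<open>N m\<close> is to be an operator norm bound of \<open>P\<close> on lists of
  length \<open>m\<close>.\<close>

primrec cone_bound :: "(nat \<Rightarrow> real) \<Rightarrow> nat \<Rightarrow> real" where
  "cone_bound N 0 = 0"
| "cone_bound N (Suc m) = N (Suc m) + real (Suc m) * cone_bound N m"

lemma abs_cone_htp_le:
  assumes P: "\<And>c B xs. (\<And>ys. \<bar>c ys\<bar> \<le> B) \<Longrightarrow> \<bar>P c xs\<bar> \<le> N (length xs) * B"
    and "\<And>ys. \<bar>c ys\<bar> \<le> B" "length xs = m"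
  shows "\<bar>cone_htp P v m c xs\<bar> \<le> cone_bound N m * B"
  using assms(2,3)
proof (induction m arbitrary: c xs)
  case (Suc m)
  let ?c = "\<lambda>ys. c (v (hd xs) # ys)"
  have "\<bar>P ?c xs\<bar> \<le> N (length xs) * B" by (rule P) (use Suc in auto)
  moreover have "\<bar>codiff (cone_htp P v m ?c) xs\<bar> \<le> real (length xs) * (cone_bound N m * B)"
    by (rule abs_codiff_le) (use Suc in auto)
  ultimately show ?case using Suc.prems by (simp add: algebra_simps)
qed simp

subsection \<open>Limits along ultrafilters\<close>

text \<open>Zorn for the reversed order on proper filters. A minimal one decides every
  \<open>P\<close>: its meet with the principal filter of \<open>P\<close> is either trivial or the
  filter itself.\<close>

lemma ultrafilter_below:
  fixes F :: "'i filter"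
  assumes "F \<noteq> bot"
  obtains U where "U \<le> F" "U \<noteq> bot" "\<And>P. eventually P U \<or> eventually (\<lambda>x. \<not> P x) U"
proof -
  let ?A = "{G. G \<le> F \<and> G \<noteq> bot}"
  have po: "partial_order_on ?A {(x, y). x \<in> ?A \<and> y \<in> ?A \<and> y \<le> x}"
    by (auto simp: partial_order_on_def preorder_on_def refl_on_def trans_def antisym_def)
  have "\<exists>U\<in>?A. \<forall>G\<in>?A. G \<le> U \<longrightarrow> G = U"
  proof -
    have "\<exists>m\<in>?A. \<forall>a\<in>?A. (\<lambda>x y. y \<le> x) m a \<longrightarrow> a = m"
    proof (rule predicate_Zorn)
      show "partial_order_on ?A (relation_of (\<lambda>x y. y \<le> x) ?A)"
        using po by (simp add: relation_of_def)
      fix C assume C: "C \<in> Chains (relation_of (\<lambda>x y. y \<le> x) ?A)"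
      then have CA: "C \<subseteq> ?A" and lin: "\<And>G H. G \<in> C \<Longrightarrow> H \<in> C \<Longrightarrow> G \<le> H \<or> H \<le> G"
        by (auto simp: Chains_def relation_of_def)
      show "\<exists>u\<in>?A. \<forall>a\<in>C. u \<le> a"
      proof (cases "C = {}")
        case True
        then show ?thesis using assms by auto
      next
        case False
        have "Inf C \<noteq> bot"
        proof -
          have "eventually P (Inf C) \<longleftrightarrow> (\<exists>b\<in>C. eventually P b)" for P
          proof (rule eventually_Inf_base[OF False])
            fix G H assume "G \<in> C" "H \<in> C"
            with lin[OF this] show "\<exists>x\<in>C. x \<le> inf G H" by (metis le_inf_iff order_refl)
          qed
          from this[of "\<lambda>_. False"] show ?thesis
            using CA by (auto simp: trivial_limit_def)
        qed
        moreover have "Inf C \<le> F" using CA False by (auto intro: Inf_lower2)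
        ultimately show ?thesis by (auto intro: Inf_lower)
      qed
    qed
    then show ?thesis by blast
  qed
  then obtain U where U: "U \<le> F" "U \<noteq> bot" and max: "\<And>G. G \<le> F \<Longrightarrow> G \<noteq> bot \<Longrightarrow> G \<le> U \<Longrightarrow> G = U"
    by blast
  have "eventually P U \<or> eventually (\<lambda>x. \<not> P x) U" for P
  proof (cases "inf U (principal {x. P x}) = bot")
    case True
    then have "eventually (\<lambda>x. False) (inf U (principal {x. P x}))" by simp
    then have "eventually (\<lambda>x. \<not> P x) U" by (simp add: eventually_inf_principal)
    then show ?thesis ..
  next
    case False
    have "inf U (principal {x. P x}) = U"
      by (rule max) (use False U in \<open>auto intro: le_infI1\<close>)
    moreover have "eventually P (inf U (principal {x. P x}))" by (simp add: eventually_inf_principal)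
    ultimately show ?thesis by simp
  qed
  with U that show ?thesis by blast
qed

text \<open>Compactness gives a cluster point, and for an ultrafilter a cluster point is a
  limit.\<close>

lemma bounded_tendsto_ultrafilter:
  fixes f :: "'i \<Rightarrow> real"
  assumes "U \<noteq> bot" and ultra: "\<And>P. eventually P U \<or> eventually (\<lambda>x. \<not> P x) U"
    and B: "\<And>i. \<bar>f i\<bar> \<le> B"
  shows "\<exists>l. (f \<longlongrightarrow> l) U"
proof -
  have "compact {-B..B}" by simp
  moreover have "filtermap f U \<noteq> bot" using assms(1) by (simp add: filtermap_bot_iff)
  moreover have "eventually (\<lambda>y. y \<in> {-B..B}) (filtermap f U)"
    unfolding eventually_filtermap using B by (intro always_eventually) (metis abs_le_D1 abs_le_D2 atLeastAtMost_iff minus_le_iff)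
  ultimately obtain l where l: "inf (nhds l) (filtermap f U) \<noteq> bot"
    unfolding compact_filter by blast
  have "(f \<longlongrightarrow> l) U"
    unfolding tendsto_def
  proof (intro allI impI)
    fix S assume S: "open S" "l \<in> S"
    show "eventually (\<lambda>x. f x \<in> S) U"
    proof (rule ccontr)
      assume "\<not> ?thesis"
      then have "eventually (\<lambda>x. f x \<notin> S) U" using ultra by blast
      then have "eventually (\<lambda>y. y \<notin> S) (filtermap f U)" by (simp add: eventually_filtermap)
      moreover have "eventually (\<lambda>y. y \<in> S) (nhds l)" using S by (rule eventually_nhds_in_open)
      ultimately have "eventually (\<lambda>y. False) (inf (nhds l) (filtermap f U))"
        unfolding eventually_inf by auto
      with l show False by (simp add: eventually_False)
    qed
  qed
  then show ?thesis ..
qed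

text \<open>The properties of an ultrafilter limit that the proof uses. Linearity is stated for
  bounded families only, since an unbounded one need not converge.\<close>

locale limit_functional =
  fixes F :: "'i filter" and L :: "('i \<Rightarrow> real) \<Rightarrow> real"
  assumes L_diff: "\<And>f g B C. (\<And>i. \<bar>f i\<bar> \<le> B) \<Longrightarrow> (\<And>i. \<bar>g i\<bar> \<le> C) \<Longrightarrow> L (\<lambda>i. f i - g i) = L f - L g"
    and L_bound: "\<And>f B. (\<And>i. \<bar>f i\<bar> \<le> B) \<Longrightarrow> \<bar>L f\<bar> \<le> B"
    and L_cong: "\<And>f g. eventually (\<lambda>i. f i = g i) F \<Longrightarrow> L f = L g"
    and L_const: "\<And>r. L (\<lambda>i. r) = r"
begin

lemma L_codiff:
  assumes "\<And>i ys. \<bar>f i ys\<bar> \<le> B"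
  shows "codiff (\<lambda>ys. L (\<lambda>i. f i ys)) xs = L (\<lambda>i. codiff (f i) xs)"
  using assms
proof (induction xs arbitrary: f)
  case (Cons v xs)
  have "L (\<lambda>i. f i xs - codiff (\<lambda>ys. f i (v # ys)) xs) = L (\<lambda>i. f i xs) - L (\<lambda>i. codiff (\<lambda>ys. f i (v # ys)) xs)"
    by (rule L_diff[of _ B _ "real (length xs) * B"]) (auto intro!: abs_codiff_le Cons.prems)
  then show ?case using Cons by simp
qed (simp add: L_const)

end

lemma limit_functional_exists:
  fixes F :: "'i filter"
  assumes "F \<noteq> bot"
  shows "\<exists>L. limit_functional F L"
proof -
  obtain U where U: "U \<le> F" "U \<noteq> bot" "\<And>P. eventually P U \<or> eventually (\<lambda>x. \<not> P x) U"
    using ultrafilter_below[OF assms] by blast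
  define L where "L f = Lim U f" for f :: "'i \<Rightarrow> real"
  have tends: "(f \<longlongrightarrow> L f) U" if "\<And>i. \<bar>f i\<bar> \<le> B" for f B
  proof -
    have "\<exists>l. (f \<longlongrightarrow> l) U" by (rule bounded_tendsto_ultrafilter[OF U(2,3) that])
    then obtain l where l: "(f \<longlongrightarrow> l) U" ..
    then show ?thesis using tendsto_Lim[OF U(2) l] by (simp add: L_def)
  qed
  show ?thesis
  proof (intro exI limit_functional.intro)
    show "L (\<lambda>i. f i - g i) = L f - L g"
      if "\<And>i. \<bar>f i\<bar> \<le> B" "\<And>i. \<bar>g i\<bar> \<le> C" for f g B C
      unfolding L_def[of "\<lambda>i. f i - g i"]
      by (rule tendsto_Lim[OF U(2)]) (intro tendsto_diff tends[OF that(1)] tends[OF that(2)])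
    show "\<bar>L f\<bar> \<le> B" if "\<And>i. \<bar>f i\<bar> \<le> B" for f B
    proof -
      have "((\<lambda>i. \<bar>f i\<bar>) \<longlongrightarrow> \<bar>L f\<bar>) U" by (intro tendsto_rabs tends[OF that])
      then show ?thesis by (rule tendsto_upperbound) (use that U(2) in auto)
    qed
    show "L f = L g" if "eventually (\<lambda>i. f i = g i) F" for f g
    proof -
      have "eventually (\<lambda>i. f i = g i) U" using that U(1) by (simp add: le_filter_def)
      then have "(f \<longlongrightarrow> l) U \<longleftrightarrow> (g \<longlongrightarrow> l) U" for l by (rule tendsto_cong)
      then show ?thesis by (simp add: L_def Topological_Spaces.Lim_def)
    qed
    show "L (\<lambda>i. r) = r" for r unfolding L_def by (rule tendsto_Lim[OF U(2)]) simp
  qed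
qed

subsection \<open>Bounded acyclicity of binate groups\<close>

text \<open>The difference of two chain maps on the diagonal simplex: Alexander--Whitney followed by
  Eilenberg--Zilber, and the identity.\<close>

definition diag_htp_map :: "(('a \<times> 'a) list \<Rightarrow> real) \<Rightarrow> 'a list \<Rightarrow> real" where
  "diag_htp_map c xs = (if xs = [] then 0
     else aw (ez (length xs - 1) c) xs - c (map (\<lambda>x. (x, x)) xs))"

lemma diag_htp_map_diff:
  "diag_htp_map (\<lambda>ys. c ys - d ys) xs = diag_htp_map c xs - diag_htp_map d xs"
  by (simp add: diag_htp_map_def ez_diff[abs_def] aw_diff)

lemma diag_htp_map_Nil [simp]: "diag_htp_map c [] = 0"
  by (simp add: diag_htp_map_def)

text \<open>Composition of \<open>ez_codiff\<close> and \<open>aw_tcodiff\<close>. On a vertex the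
  two chain maps agree, so their difference has zero augmentation and coning applies to it.\<close>

lemma diag_htp_map_codiff:
  assumes "xs \<noteq> []"
  shows "diag_htp_map (codiff c) xs = codiff (diag_htp_map c) xs"
proof (cases "length xs = 1")
  case True
  then obtain x where "xs = [x]" by (auto simp: length_Suc_conv)
  then show ?thesis by (simp add: diag_htp_map_def edge_path_def)
next
  case False
  define m where "m = length xs - 2"
  have len: "length xs = m + 2" using assms False by (cases xs; cases "tl xs") (auto simp: m_def)
  have "aw (ez (Suc m) (codiff c)) xs = aw (tcodiff (ez m c)) xs"
    by (rule aw_cong, rule ez_codiff) (use len in auto)
  also have "\<dots> = codiff (aw (ez m c)) xs" by (rule aw_tcodiff)
  finally have "diag_htp_map (codiff c) xs = codiff (\<lambda>ys. aw (ez m c) ys - c (map (\<lambda>x. (x, x)) ys)) xs"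
    using len assms by (simp add: diag_htp_map_def codiff_diff codiff_map del: ez.simps)
  also have "\<dots> = codiff (diag_htp_map c) xs"
    by (rule codiff_cong) (use len in \<open>auto simp: diag_htp_map_def\<close>)
  finally show ?thesis .
qed

lemma diag_htp_map_map:
  "diag_htp_map c (map a xs) = diag_htp_map (\<lambda>ys. c (map (map_prod a a) ys)) xs"
proof -
  have "aw (ez m c) (map a xs) = aw (ez m (\<lambda>ys. c (map (map_prod a a) ys))) xs" for m
    unfolding aw_map by (rule aw_cong) (simp add: ez_map)
  then show ?thesis by (simp add: diag_htp_map_def comp_def)
qed

lemma abs_diag_htp_map_le:
  assumes B: "\<And>ys. \<bar>c ys\<bar> \<le> B"
  shows "\<bar>diag_htp_map c xs\<bar> \<le> (real (length xs) * ez_bound (length xs - 1) + 1) * B"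
proof (cases "xs = []")
  case True
  then show ?thesis using B[of "[]"] by simp
next
  case False
  have "\<bar>aw (ez (length xs - 1) c) xs\<bar> \<le> real (length xs) * (ez_bound (length xs - 1) * B)"
    by (rule abs_aw_le, rule abs_ez_le) (use B False in \<open>auto simp: Suc_le_eq\<close>)
  moreover have "\<bar>c (map (\<lambda>x. (x, x)) xs)\<bar> \<le> B" by (rule B)
  ultimately show ?thesis using False by (simp add: diag_htp_map_def algebra_simps)
qed

text \<open>Cochains are total functions on lists. Entries outside the carrier are read as \<open>\<one>\<close>, so
  that invariance and the cocycle identity need no carrier conditions.\<close>

definition (in group) rep :: "'a \<Rightarrow> 'a" where
  "rep x = (if x \<in> carrier G then x else \<one>)"

definition (in group) act :: "'a \<Rightarrow> 'a \<Rightarrow> 'a" where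
  "act g x = g \<otimes> rep x"

definition (in group) invariant :: "('a list \<Rightarrow> real) \<Rightarrow> bool" where
  "invariant c \<longleftrightarrow> (\<forall>g\<in>carrier G. \<forall>xs. c (map (act g) xs) = c xs)"

text \<open>The bound on the primitive depends only on the bound on the cocycle. This uniformity is
  needed when primitives are chosen for a whole family of cocycles at once.\<close>

definition (in group) bc_vanishes :: "nat \<Rightarrow> bool" where
  "bc_vanishes n \<longleftrightarrow> (\<forall>B. \<exists>B'. \<forall>c. (\<forall>xs. \<bar>c xs\<bar> \<le> B) \<longrightarrow> invariant c \<longrightarrow>
     (\<forall>xs. length xs = n + 2 \<longrightarrow> codiff c xs = 0) \<longrightarrow>
     (\<exists>b. (\<forall>xs. \<bar>b xs\<bar> \<le> B') \<and> invariant b \<and> (\<forall>xs. length xs = n + 1 \<longrightarrow> codiff b xs = c xs)))"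

definition (in group) biinvariant :: "('a list \<Rightarrow> 'a list \<Rightarrow> real) \<Rightarrow> bool" where
  "biinvariant f \<longleftrightarrow> (\<forall>g\<in>carrier G. \<forall>gs hs. f (map (act g) gs) hs = f gs hs \<and> f gs (map (act g) hs) = f gs hs)"

context group
begin

lemma rep_closed [simp]: "rep x \<in> carrier G"
  by (simp add: rep_def)

lemma rep_id [simp]: "x \<in> carrier G \<Longrightarrow> rep x = x"
  by (simp add: rep_def)

lemma act_closed [simp]: "g \<in> carrier G \<Longrightarrow> act g x \<in> carrier G"
  by (simp add: act_def)

lemma act_act: "g \<in> carrier G \<Longrightarrow> h \<in> carrier G \<Longrightarrow> act g (act h x) = act (g \<otimes> h) x"
  by (simp add: act_def m_assoc)

lemma act_inv_rep [simp]: "act (inv (rep x)) x = \<one>"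
  by (simp add: act_def)

lemma invariantD: "invariant c \<Longrightarrow> g \<in> carrier G \<Longrightarrow> c (map (act g) xs) = c xs"
  by (simp add: invariant_def)

lemma biinvariantD:
  assumes "biinvariant f" "g \<in> carrier G"
  shows "f (map (act g) gs) hs = f gs hs" "f gs (map (act g) hs) = f gs hs"
  using assms by (simp_all add: biinvariant_def)

text \<open>Translating one variable alone moves its only vertex to the unit.\<close>

lemma biinvariant_singleton:
  assumes "biinvariant f"
  shows "f [x] hs = f [\<one>] hs" "f gs [x] = f gs [\<one>]"
  using biinvariantD[OF assms, of "inv (rep x)"] by (metis act_inv_rep inv_closed list.simps(8,9) rep_closed)+

lemma biinvariant_tcodiff:
  assumes "biinvariant f"
  shows "biinvariant (tcodiff f)"
proof -
  have "f (map (act g) gs) = f gs" if "g \<in> carrier G" for g gs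
    using biinvariantD(1)[OF assms that] by blast
  then show ?thesis
    by (simp add: biinvariant_def tcodiff_def rcodiff_def codiff_map biinvariantD[OF assms])
qed

lemma biinvariant_diff: "biinvariant f \<Longrightarrow> biinvariant f' \<Longrightarrow> biinvariant (\<lambda>gs hs. f gs hs - f' gs hs)"
  by (simp add: biinvariant_def)

text \<open>A cocycle on a product of two copies of the group is made to vanish on all cells of bidegree
  \<open>(p, q)\<close> with \<open>1 \<le> p \<le> j\<close> and \<open>q \<ge> 1\<close>. Once it vanishes for smaller \<open>p\<close> it is a cocycle in the second
  variable, of positive degree below \<open>n\<close>, and has a primitive there. The primitive is chosen for first
  variables that start with \<open>\<one>\<close>, which keeps it invariant.\<close>

lemma straighten:
  assumes vanish: "\<And>p. 1 \<le> p \<Longrightarrow> p < n \<Longrightarrow> bc_vanishes p" and "1 \<le> n" "j \<le> n - 1" "0 \<le> B"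
  shows "\<exists>B'\<ge>0. \<forall>f. (\<forall>gs hs. gs \<noteq> [] \<longrightarrow> hs \<noteq> [] \<longrightarrow> length gs + length hs = n + 2 \<longrightarrow> \<bar>f gs hs\<bar> \<le> B)
    \<longrightarrow> biinvariant f
    \<longrightarrow> (\<forall>gs hs. gs \<noteq> [] \<longrightarrow> hs \<noteq> [] \<longrightarrow> length gs + length hs = n + 3 \<longrightarrow> tcodiff f gs hs = 0)
    \<longrightarrow> (\<exists>b. (\<forall>gs hs. \<bar>b gs hs\<bar> \<le> B') \<and> biinvariant b \<and> (\<forall>gs hs. length gs \<le> 1 \<longrightarrow> b gs hs = 0) \<and>
         (\<forall>gs hs. 2 \<le> length gs \<longrightarrow> length gs \<le> Suc j \<longrightarrow> 2 \<le> length hs \<longrightarrow> length gs + length hs = n + 2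
            \<longrightarrow> f gs hs = tcodiff b gs hs))"
  using assms(3)
proof (induction j)
  case 0
  show ?case
    by (intro exI[of _ "0::real"] conjI order_refl allI impI exI[of _ "\<lambda>_ _. 0::real"]) (auto simp: biinvariant_def)
next
  case (Suc j)
  then obtain B' where B'0: "0 \<le> B'" and B': "\<forall>f. (\<forall>gs hs. gs \<noteq> [] \<longrightarrow> hs \<noteq> [] \<longrightarrow> length gs + length hs = n + 2 \<longrightarrow> \<bar>f gs hs\<bar> \<le> B)
    \<longrightarrow> biinvariant f
    \<longrightarrow> (\<forall>gs hs. gs \<noteq> [] \<longrightarrow> hs \<noteq> [] \<longrightarrow> length gs + length hs = n + 3 \<longrightarrow> tcodiff f gs hs = 0)
    \<longrightarrow> (\<exists>b. (\<forall>gs hs. \<bar>b gs hs\<bar> \<le> B') \<and> biinvariant b \<and> (\<forall>gs hs. length gs \<le> 1 \<longrightarrow> b gs hs = 0) \<and>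
         (\<forall>gs hs. 2 \<le> length gs \<longrightarrow> length gs \<le> Suc j \<longrightarrow> 2 \<le> length hs \<longrightarrow> length gs + length hs = n + 2
            \<longrightarrow> f gs hs = tcodiff b gs hs))"
    by auto
  \<comment> \<open>First variables with \<open>j + 2\<close> entries have degree
    \<open>j + 1\<close>, which leaves degree \<open>p\<close> for the second variable.\<close>
  define p where "p = n - 1 - j"
  have p: "1 \<le> p" "p < n" "n = p + 1 + j" using Suc.prems assms(2) by (auto simp: p_def)
  \<comment> \<open>Bounds \<open>f - tcodiff b\<close>: the two lists together have
    \<open>n + 2\<close> entries, hence at most so many faces.\<close>
  define C where "C = B + real (n + 2) * B'"
  have C0: "0 \<le> C" using B'0 assms(4) by (simp add: C_def)
  from vanish[OF p(1,2)] obtain B'' where B'': "\<forall>c. (\<forall>xs. \<bar>c xs\<bar> \<le> C) \<longrightarrow> invariant c \<longrightarrow>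
     (\<forall>xs. length xs = p + 2 \<longrightarrow> codiff c xs = 0) \<longrightarrow>
     (\<exists>b. (\<forall>xs. \<bar>b xs\<bar> \<le> B'') \<and> invariant b \<and> (\<forall>xs. length xs = p + 1 \<longrightarrow> codiff b xs = c xs))"
    unfolding bc_vanishes_def by blast
  show ?case
  proof (intro exI[of _ "B' + \<bar>B''\<bar>"] conjI allI impI)
    show "0 \<le> B' + \<bar>B''\<bar>" using B'0 by simp
    fix f :: "'a list \<Rightarrow> 'a list \<Rightarrow> real"
    assume fB: "\<forall>gs hs. gs \<noteq> [] \<longrightarrow> hs \<noteq> [] \<longrightarrow> length gs + length hs = n + 2 \<longrightarrow> \<bar>f gs hs\<bar> \<le> B"
      and finv: "biinvariant f"
      and fco: "\<forall>gs hs. gs \<noteq> [] \<longrightarrow> hs \<noteq> [] \<longrightarrow> length gs + length hs = n + 3 \<longrightarrow> tcodiff f gs hs = 0"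
    from B'[rule_format, OF fB[rule_format] finv fco[rule_format]]
    obtain b where b: "\<forall>gs hs. \<bar>b gs hs\<bar> \<le> B'" "biinvariant b" "\<forall>gs hs. length gs \<le> 1 \<longrightarrow> b gs hs = 0"
         "\<forall>gs hs. 2 \<le> length gs \<longrightarrow> length gs \<le> Suc j \<longrightarrow> 2 \<le> length hs \<longrightarrow> length gs + length hs = n + 2
            \<longrightarrow> f gs hs = tcodiff b gs hs"
      by blast
    define f' where "f' gs hs = f gs hs - tcodiff b gs hs" for gs hs
    have f'B: "\<bar>f' gs hs\<bar> \<le> C" if "gs \<noteq> []" "hs \<noteq> []" "length gs + length hs = n + 2" for gs hs
    proof -
      have "\<bar>tcodiff b gs hs\<bar> \<le> real (length gs + length hs) * B'"
        by (rule abs_tcodiff_le) (use b(1) B'0 that in auto)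
      moreover have "\<bar>f gs hs\<bar> \<le> B" using fB that by blast
      ultimately show ?thesis using that(3) by (simp add: f'_def C_def)
    qed
    have f'inv: "biinvariant f'"
      unfolding f'_def[abs_def] by (intro biinvariant_diff finv biinvariant_tcodiff b(2))
    have f'co: "tcodiff f' gs hs = 0" if "gs \<noteq> []" "hs \<noteq> []" "length gs + length hs = n + 3" for gs hs
      unfolding f'_def[abs_def] tcodiff_diff using fco that by (simp add: tcodiff_tcodiff)
    have f'0: "f' gs hs = 0" if "2 \<le> length gs" "length gs \<le> Suc j" "2 \<le> length hs" "length gs + length hs = n + 2" for gs hs
      using b(4) that by (simp add: f'_def)
    \<comment> \<open>Cut off to one length, because \<open>bc_vanishes\<close> requires a bound on
      all lists.\<close>
    define c where "c gs hs = (if length hs = p + 1 then f' gs hs else 0)" for gs hs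
    have "\<exists>\<beta>. (\<forall>xs. \<bar>\<beta> xs\<bar> \<le> B'') \<and> invariant \<beta> \<and> (\<forall>xs. length xs = p + 1 \<longrightarrow> codiff \<beta> xs = c gs xs)"
      if gs: "length gs = j + 2" for gs
    proof (rule B''[rule_format])
      show "\<bar>c gs xs\<bar> \<le> C" for xs
        unfolding c_def using f'B[of gs xs] C0 gs p(3) by (cases "xs = []"; cases "gs = []") auto
      show "invariant (c gs)"
        using biinvariantD(2)[OF f'inv] by (simp add: invariant_def c_def)
      fix hs :: "'a list" assume hs: "length hs = p + 2"
      have "codiff (c gs) hs = codiff (f' gs) hs"
        by (rule codiff_cong) (use hs in \<open>auto simp: c_def\<close>)
      \<comment> \<open>The part of the cocycle identity in the first variable drops out: for
        \<open>j = 0\<close> both faces are points and agree by invariance, otherwise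
        \<open>f'\<close> already vanishes on all faces.\<close>
      moreover have "rcodiff (\<lambda>ys. f' ys hs) gs = 0"
      proof (cases "j = 0")
        case True
        then obtain x y where "gs = [x, y]" using gs by (auto simp: length_Suc_conv numeral_2_eq_2)
        moreover have "f' [x] hs = f' [y] hs"
          using biinvariant_singleton(1)[OF f'inv, of x hs] biinvariant_singleton(1)[OF f'inv, of y hs] by simp
        ultimately show ?thesis by (simp add: rcodiff_def)
      next
        case False
        have "codiff (\<lambda>ys. f' ys hs) gs = codiff (\<lambda>ys. 0) gs"
          by (rule codiff_cong, rule f'0) (use False gs hs p in auto)
        then show ?thesis by (simp add: rcodiff_def)
      qed
      moreover have "tcodiff f' gs hs = 0"
        by (rule f'co) (use gs hs p in auto)
      ultimately show "codiff (c gs) hs = 0"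
        using hs by (simp add: tcodiff_def rcodiff_def)
    qed
    then have "\<forall>gs. \<exists>\<beta>. length gs = j + 2 \<longrightarrow> (\<forall>xs. \<bar>\<beta> xs\<bar> \<le> B'') \<and> invariant \<beta> \<and> (\<forall>xs. length xs = p + 1 \<longrightarrow> codiff \<beta> xs = c gs xs)"
      by blast
    then obtain \<beta> where "\<forall>gs. length gs = j + 2 \<longrightarrow> (\<forall>xs. \<bar>\<beta> gs xs\<bar> \<le> B'') \<and> invariant (\<beta> gs) \<and> (\<forall>xs. length xs = p + 1 \<longrightarrow> codiff (\<beta> gs) xs = c gs xs)"
      by (rule choice[THEN exE])
    then have \<beta>: "\<bar>\<beta> gs xs\<bar> \<le> B''" "invariant (\<beta> gs)" "length xs = p + 1 \<Longrightarrow> codiff (\<beta> gs) xs = c gs xs"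
      if "length gs = j + 2" for gs xs
      using that by blast+
    define nrm where "nrm gs = map (act (inv (rep (hd gs)))) gs" for gs
    have nrm: "length (nrm gs) = length gs" for gs by (simp add: nrm_def)
    have nrm_act: "nrm (map (act g) gs) = nrm gs" if "g \<in> carrier G" for g gs
    proof -
      have "act (inv (act g x)) (act g y) = act (inv (rep x)) y" for x y
        using that by (simp add: act_act) (simp add: act_def inv_mult_group m_assoc)
      then show ?thesis using that by (cases gs) (simp_all add: nrm_def)
    qed
    \<comment> \<open>The sign cancels the one that \<open>tcodiff\<close> puts before the second
      variable. As \<open>e\<close> vanishes on shorter first variables, the bidegrees treated
      before are not disturbed.\<close>
    define e where "e gs hs = (if length gs = j + 2 then (-1) ^ (j + 1) * \<beta> (nrm gs) hs else 0)" for gs hs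
    have einv: "biinvariant e"
      unfolding biinvariant_def e_def
      using nrm_act \<beta>(2) by (auto simp: nrm invariantD)
    have eB: "\<bar>e gs hs\<bar> \<le> \<bar>B''\<bar>" for gs hs
      using \<beta>(1)[of "nrm gs" hs] by (auto simp: e_def nrm abs_mult)
    have te: "tcodiff e gs hs = (if length gs = j + 2 then f' gs hs else 0)"
      if "2 \<le> length gs" "length gs \<le> j + 2" "2 \<le> length hs" "length gs + length hs = n + 2" for gs hs
    proof -
      have "codiff (\<lambda>ys. e ys hs) gs = codiff (\<lambda>ys. 0) gs"
        by (rule codiff_cong) (use that in \<open>auto simp: e_def\<close>)
      then have 1: "tcodiff e gs hs = (-1) ^ (length gs - 1) * codiff (e gs) hs"
        using that by (simp add: tcodiff_def rcodiff_def)
      show ?thesis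
      proof (cases "length gs = j + 2")
        case True
        then have len: "length hs = p + 1" using that p by simp
        have "codiff (e gs) hs = (-1) ^ (j + 1) * codiff (\<beta> (nrm gs)) hs"
          using True by (simp add: e_def[abs_def] flip: codiff_cmult)
        also have "codiff (\<beta> (nrm gs)) hs = f' (nrm gs) hs"
          using \<beta>(3)[of "nrm gs" hs] True len by (simp add: nrm c_def)
        also have "\<dots> = f' gs hs" unfolding nrm_def by (rule biinvariantD(1)[OF f'inv]) simp
        finally show ?thesis using True by (simp add: 1 flip: power_add mult.assoc)
      next
        case False
        have "codiff (e gs) hs = codiff (\<lambda>ys. 0) hs"
          by (rule codiff_cong) (use False in \<open>auto simp: e_def\<close>)
        then show ?thesis using False 1 by simp
      qed
    qed
    show "\<exists>b. (\<forall>gs hs. \<bar>b gs hs\<bar> \<le> B' + \<bar>B''\<bar>) \<and> biinvariant b \<and> (\<forall>gs hs. length gs \<le> 1 \<longrightarrow> b gs hs = 0) \<and>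
         (\<forall>gs hs. 2 \<le> length gs \<longrightarrow> length gs \<le> Suc (Suc j) \<longrightarrow> 2 \<le> length hs \<longrightarrow> length gs + length hs = n + 2
            \<longrightarrow> f gs hs = tcodiff b gs hs)"
    proof (intro exI[of _ "\<lambda>gs hs. b gs hs + e gs hs"] conjI allI impI)
      show "\<bar>b gs hs + e gs hs\<bar> \<le> B' + \<bar>B''\<bar>" for gs hs
        using b(1)[rule_format, of gs hs] eB[of gs hs] by linarith
      show "biinvariant (\<lambda>gs hs. b gs hs + e gs hs)"
        using b(2) einv by (simp add: biinvariant_def)
      show "b gs hs + e gs hs = 0" if "length gs \<le> 1" for gs hs
        using b(3) that by (simp add: e_def)
      fix gs hs :: "'a list"
      assume *: "2 \<le> length gs" "length gs \<le> Suc (Suc j)" "2 \<le> length hs" "length gs + length hs = n + 2"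
      have "tcodiff (\<lambda>gs hs. b gs hs + e gs hs) gs hs = tcodiff b gs hs + tcodiff e gs hs"
        by (rule tcodiff_add)
      also have "\<dots> = f gs hs"
        using te[of gs hs] b(4) * by (auto simp: f'_def le_Suc_eq)
      finally show "f gs hs = tcodiff (\<lambda>gs hs. b gs hs + e gs hs) gs hs" ..
    qed
  qed
qed

section \<open>The induction step for binate groups\<close>

lemma conj_mult:
  assumes "g \<in> carrier G" "x \<in> carrier G" "y \<in> carrier G"
  shows "inv g \<otimes> (x \<otimes> y) \<otimes> g = (inv g \<otimes> x \<otimes> g) \<otimes> (inv g \<otimes> y \<otimes> g)"
proof -
  have "g \<otimes> (inv g \<otimes> z) = z" if "z \<in> carrier G" for z
    using assms that by (simp flip: m_assoc)
  then show ?thesis using assms by (simp add: m_assoc)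
qed

text \<open>With \<iota>(x) the conjugate of \<phi>(x) by \<gamma>, the commutator identity reads
  \<phi>(x) = \<iota>(x) x. Expanding \<phi>(y x) = \<phi>(y) \<phi>(x) in this form and cancelling
  gives \<iota>(x) y = y \<iota>(x).\<close>

lemma binate_data:
  assumes "binate G"
  obtains \<phi> :: "'a set \<Rightarrow> 'a \<Rightarrow> 'a" and \<gamma> :: "'a set \<Rightarrow> 'a" where
    "\<And>S x. \<phi> S x \<in> carrier G" "\<And>S. \<gamma> S \<in> carrier G" "\<And>S. \<phi> S \<one> = \<one>"
    "\<And>S x y. finite S \<Longrightarrow> S \<subseteq> carrier G \<Longrightarrow> x \<in> S \<Longrightarrow> y \<in> S \<Longrightarrow> \<phi> S (x \<otimes> y) = \<phi> S x \<otimes> \<phi> S y"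
    "\<And>S x. finite S \<Longrightarrow> S \<subseteq> carrier G \<Longrightarrow> x \<in> S \<Longrightarrow> \<phi> S x = inv \<gamma> S \<otimes> \<phi> S x \<otimes> \<gamma> S \<otimes> x"
    "\<And>S x y. finite S \<Longrightarrow> S \<subseteq> carrier G \<Longrightarrow> x \<in> S \<Longrightarrow> y \<in> S \<Longrightarrow>
       (inv \<gamma> S \<otimes> \<phi> S x \<otimes> \<gamma> S) \<otimes> y = y \<otimes> (inv \<gamma> S \<otimes> \<phi> S x \<otimes> \<gamma> S)"
proof -
  define ok where "ok S \<phi> \<gamma> \<longleftrightarrow> (\<forall>x. \<phi> x \<in> carrier G) \<and> \<gamma> \<in> carrier G \<and> \<phi> \<one> = \<one> \<and>
     (finite S \<and> S \<subseteq> carrier G \<longrightarrow>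
       (\<forall>x\<in>S. \<forall>y\<in>S. \<phi> (x \<otimes> y) = \<phi> x \<otimes> \<phi> y \<and>
          (inv \<gamma> \<otimes> \<phi> x \<otimes> \<gamma>) \<otimes> y = y \<otimes> (inv \<gamma> \<otimes> \<phi> x \<otimes> \<gamma>)) \<and>
       (\<forall>x\<in>S. \<phi> x = inv \<gamma> \<otimes> \<phi> x \<otimes> \<gamma> \<otimes> x))" for S \<phi> \<gamma>
  have "\<exists>\<phi> \<gamma>. ok S \<phi> \<gamma>" for S
  proof (cases "finite S \<and> S \<subseteq> carrier G")
    case False
    \<comment> \<open>Default data for all other sets, which make \<phi> and \<gamma> total in
      \<open>S\<close>.\<close>
    then show ?thesis by (intro exI[of _ "\<lambda>_. \<one>"] exI[of _ \<one>]) (use False in \<open>auto simp: ok_def\<close>)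
  next
    case True
    let ?H = "generate G S"
    have sub: "subgroup ?H G" using True generate_is_subgroup by blast
    have "finitely_generated_subgroup ?H G"
      using sub True by (auto simp: finitely_generated_subgroup_def)
    then obtain \<phi> \<gamma> where hom: "\<phi> \<in> hom (G\<lparr>carrier := ?H\<rparr>) G" and \<gamma>: "\<gamma> \<in> carrier G"
      and eq: "\<And>h. h \<in> ?H \<Longrightarrow> h = inv \<gamma> \<otimes> inv (\<phi> h) \<otimes> \<gamma> \<otimes> \<phi> h"
      using assms unfolding binate_def by blast
    have HG: "?H \<subseteq> carrier G" by (rule subgroup.subset[OF sub])
    have \<phi>c: "\<phi> x \<in> carrier G" if "x \<in> ?H" for x
      using hom that by (auto simp: hom_def)
    have \<phi>m: "\<phi> (x \<otimes> y) = \<phi> x \<otimes> \<phi> y" if "x \<in> ?H" "y \<in> ?H" for x y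
      using hom that by (auto simp: hom_def)
    have H1: "\<one> \<in> ?H" by (rule subgroup.one_closed[OF sub])
    have \<phi>1: "\<phi> \<one> = \<one>"
      using \<phi>m[OF H1 H1] \<phi>c[OF H1] by simp
    let ?\<iota> = "\<lambda>x. inv \<gamma> \<otimes> \<phi> x \<otimes> \<gamma>"
    have \<iota>c: "?\<iota> x \<in> carrier G" if "x \<in> ?H" for x using \<gamma> \<phi>c[OF that] by simp
    have \<phi>eq: "\<phi> x = ?\<iota> x \<otimes> x" if "x \<in> ?H" for x
    proof -
      have "x = inv (?\<iota> x) \<otimes> \<phi> x"
        using eq[OF that] \<gamma> \<phi>c[OF that] by (simp add: inv_mult_group m_assoc)
      then have "?\<iota> x \<otimes> x = ?\<iota> x \<otimes> (inv (?\<iota> x) \<otimes> \<phi> x)" by simp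
      also have "\<dots> = \<phi> x" using \<iota>c[OF that] \<phi>c[OF that] by (simp flip: m_assoc)
      finally show ?thesis ..
    qed
    have comm: "?\<iota> x \<otimes> y = y \<otimes> ?\<iota> x" if x: "x \<in> ?H" and y: "y \<in> ?H" for x y
    proof -
      have xy: "y \<otimes> x \<in> ?H" using subgroup.m_closed[OF sub y x] .
      note c = \<iota>c[OF x] \<iota>c[OF y] subsetD[OF HG x] subsetD[OF HG y] \<phi>c[OF x] \<phi>c[OF y] \<gamma>
      have "?\<iota> (y \<otimes> x) = ?\<iota> y \<otimes> ?\<iota> x"
        using c by (simp only: \<phi>m[OF y x] conj_mult)
      then have "?\<iota> y \<otimes> ?\<iota> x \<otimes> (y \<otimes> x) = (?\<iota> y \<otimes> y) \<otimes> (?\<iota> x \<otimes> x)"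
        using \<phi>eq[OF xy] \<phi>eq[OF x] \<phi>eq[OF y] \<phi>m[OF y x] by metis
      then have "?\<iota> y \<otimes> (?\<iota> x \<otimes> y \<otimes> x) = ?\<iota> y \<otimes> (y \<otimes> ?\<iota> x \<otimes> x)"
        using c(1-4) by (simp only: m_assoc m_closed)
      then have "?\<iota> x \<otimes> y \<otimes> x = y \<otimes> ?\<iota> x \<otimes> x"
        using c(1-4) by (simp only: l_cancel m_closed)
      then show ?thesis using c(1-4) by (simp only: r_cancel m_closed)
    qed
    have SH: "S \<subseteq> ?H" by (auto intro: generate.incl)
    show ?thesis
    proof (intro exI[of _ "\<lambda>x. if x \<in> ?H then \<phi> x else \<one>"] exI[of _ \<gamma>])
      have "x \<in> ?H" if "x \<in> S" for x using SH that by blast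
      then show "ok S (\<lambda>x. if x \<in> ?H then \<phi> x else \<one>) \<gamma>"
        unfolding ok_def using \<gamma> \<phi>1 \<phi>c \<phi>m comm \<phi>eq H1 subgroup.m_closed[OF sub] by simp
    qed
  qed
  then have "\<forall>S. \<exists>z. ok S (fst z) (snd z)" by simp
  then obtain z where "\<forall>S. ok S (fst (z S)) (snd (z S))" by (rule choice[THEN exE])
  then have ok: "ok S (fst (z S)) (snd (z S))" for S ..
  define \<phi> \<gamma> where "\<phi> S = fst (z S)" and "\<gamma> S = snd (z S)" for S
  note ok = ok[folded \<phi>_def \<gamma>_def]
  have *: "(\<forall>x\<in>S. \<forall>y\<in>S. \<phi> S (x \<otimes> y) = \<phi> S x \<otimes> \<phi> S y \<and>
        (inv \<gamma> S \<otimes> \<phi> S x \<otimes> \<gamma> S) \<otimes> y = y \<otimes> (inv \<gamma> S \<otimes> \<phi> S x \<otimes> \<gamma> S)) \<and>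
      (\<forall>x\<in>S. \<phi> S x = inv \<gamma> S \<otimes> \<phi> S x \<otimes> \<gamma> S \<otimes> x)"
    if "finite S" "S \<subseteq> carrier G" for S
    using ok[of S, unfolded ok_def, THEN conjunct2, THEN conjunct2, THEN conjunct2] that
    by (elim mp) simp
  show ?thesis
  proof (rule that[of \<phi> \<gamma>])
    show "\<phi> S x \<in> carrier G" "\<gamma> S \<in> carrier G" "\<phi> S \<one> = \<one>" for S x
      using ok[of S] by (simp_all add: ok_def)
  next
    fix S x y assume S: "finite S" "S \<subseteq> carrier G" and x: "x \<in> S"
    show "\<phi> S x = inv \<gamma> S \<otimes> \<phi> S x \<otimes> \<gamma> S \<otimes> x"
      by (rule *[OF S, THEN conjunct2, THEN bspec, OF x])
    assume y: "y \<in> S"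
    show "\<phi> S (x \<otimes> y) = \<phi> S x \<otimes> \<phi> S y"
      by (rule *[OF S, THEN conjunct1, THEN bspec, OF x, THEN bspec, OF y, THEN conjunct1])
    show "inv \<gamma> S \<otimes> \<phi> S x \<otimes> \<gamma> S \<otimes> y = y \<otimes> (inv \<gamma> S \<otimes> \<phi> S x \<otimes> \<gamma> S)"
      by (rule *[OF S, THEN conjunct1, THEN bspec, OF x, THEN bspec, OF y, THEN conjunct2])
  qed
qed

text \<open>Pull a cocycle back along the homomorphisms \<open>(g, h) \<mapsto> \<gamma>\<^sup>-\<^sup>1 \<phi>(g) \<gamma> h\<close>, which are defined on larger and
  larger finite subsets of \<open>G\<close>, and take the limit. On the diagonal this gives the pullback along \<open>\<phi>\<close>,
  on the first factor that along the conjugate of \<open>\<phi>\<close>, and on the second factor the cocycle itself.\<close>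

lemma bc_vanishes_step:
  assumes "binate G" and n: "1 \<le> n" and vanish: "\<And>p. 1 \<le> p \<Longrightarrow> p < n \<Longrightarrow> bc_vanishes p"
  shows "bc_vanishes n"
proof -
  obtain \<phi> \<gamma> where \<phi>c: "\<And>S x. \<phi> S x \<in> carrier G" and \<gamma>c: "\<And>S. \<gamma> S \<in> carrier G" and \<phi>1: "\<And>S. \<phi> S \<one> = \<one>"
    and \<phi>m: "\<And>S x y. finite S \<Longrightarrow> S \<subseteq> carrier G \<Longrightarrow> x \<in> S \<Longrightarrow> y \<in> S \<Longrightarrow> \<phi> S (x \<otimes> y) = \<phi> S x \<otimes> \<phi> S y"
    and \<phi>eq0: "\<And>S x. finite S \<Longrightarrow> S \<subseteq> carrier G \<Longrightarrow> x \<in> S \<Longrightarrow> \<phi> S x = inv \<gamma> S \<otimes> \<phi> S x \<otimes> \<gamma> S \<otimes> x"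
    and comm0: "\<And>S x y. finite S \<Longrightarrow> S \<subseteq> carrier G \<Longrightarrow> x \<in> S \<Longrightarrow> y \<in> S \<Longrightarrow>
       (inv \<gamma> S \<otimes> \<phi> S x \<otimes> \<gamma> S) \<otimes> y = y \<otimes> (inv \<gamma> S \<otimes> \<phi> S x \<otimes> \<gamma> S)"
    by (rule binate_data[OF assms(1)]) (rule that)
  define F where "F = finite_subsets_at_top (carrier G)"
  have F: "F \<noteq> bot" by (simp add: F_def finite_subsets_at_top_neq_bot)
  have evF: "eventually P F" if "finite T" "T \<subseteq> carrier G" "\<And>S. finite S \<Longrightarrow> S \<subseteq> carrier G \<Longrightarrow> T \<subseteq> S \<Longrightarrow> P S" for P T
    unfolding F_def eventually_finite_subsets_at_top using that by blast
  obtain L where "limit_functional F L" using limit_functional_exists[OF F] ..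
  then interpret limit_functional F L .
  define \<iota> where "\<iota> S x = inv \<gamma> S \<otimes> \<phi> S x \<otimes> \<gamma> S" for S x
  have \<iota>c: "\<iota> S x \<in> carrier G" for S x using \<phi>c \<gamma>c by (simp add: \<iota>_def)
  have \<iota>1: "\<iota> S \<one> = \<one>" for S using \<gamma>c by (simp add: \<iota>_def \<phi>1)
  have \<phi>eq: "\<phi> S x = \<iota> S x \<otimes> x" if "finite S" "S \<subseteq> carrier G" "x \<in> S" for S x
    using \<phi>eq0[OF that] by (simp add: \<iota>_def)
  have comm: "\<iota> S x \<otimes> y = y \<otimes> \<iota> S x" if "finite S" "S \<subseteq> carrier G" "x \<in> S" "y \<in> S" for S x y
    using comm0[OF that] by (simp add: \<iota>_def)
  have \<iota>m: "\<iota> S (x \<otimes> y) = \<iota> S x \<otimes> \<iota> S y" if "finite S" "S \<subseteq> carrier G" "x \<in> S" "y \<in> S" for S x y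
    using \<phi>c \<gamma>c by (simp only: \<phi>m[OF that] \<iota>_def conj_mult)
  define ev where "ev S z = \<iota> S (rep (fst z)) \<otimes> rep (snd z)" for S z
  have evc: "ev S z \<in> carrier G" for S z using \<iota>c by (simp add: ev_def)
  define \<Phi> where "\<Phi> S x = \<phi> S (rep x)" for S x
  \<comment> \<open>Right translation by \<gamma> minus the identity. Right translation commutes
    with the left action, so the coned homotopy is invariant. By left invariance of
    \<open>c\<close>, pulling back along \<iota> is pulling back along \<phi> followed by this
    translation; this is why conjugation acts trivially.\<close>
  define P2 where "P2 S c xs = c (map (\<lambda>y. rep y \<otimes> \<gamma> S) xs) - c xs" for S and c :: "'a list \<Rightarrow> real" and xs
  define D2 where "D2 c S = cone_htp (P2 S) id n c" for c S
  show ?thesis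
    unfolding bc_vanishes_def
  proof
    fix B
    show "\<exists>B'. \<forall>c. (\<forall>xs. \<bar>c xs\<bar> \<le> B) \<longrightarrow> invariant c \<longrightarrow>
     (\<forall>xs. length xs = n + 2 \<longrightarrow> codiff c xs = 0) \<longrightarrow>
     (\<exists>b. (\<forall>xs. \<bar>b xs\<bar> \<le> B') \<and> invariant b \<and> (\<forall>xs. length xs = n + 1 \<longrightarrow> codiff b xs = c xs))"
    proof (cases "0 \<le> B")
      case False
      then have "\<not> (\<forall>xs. \<bar>c xs\<bar> \<le> B)" for c :: "'a list \<Rightarrow> real"
        by (metis abs_ge_zero order_trans)
      then show ?thesis by blast
    next
      case B0: True
      have "0 \<le> ez_bound n * B" using B0 ez_bound_pos[of n] by simp
      from straighten[OF vanish n order_refl this]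
      obtain B' where B'0: "0 \<le> B'" and B': "\<forall>f. (\<forall>gs hs. gs \<noteq> [] \<longrightarrow> hs \<noteq> [] \<longrightarrow> length gs + length hs = n + 2 \<longrightarrow> \<bar>f gs hs\<bar> \<le> ez_bound n * B)
        \<longrightarrow> biinvariant f
        \<longrightarrow> (\<forall>gs hs. gs \<noteq> [] \<longrightarrow> hs \<noteq> [] \<longrightarrow> length gs + length hs = n + 3 \<longrightarrow> tcodiff f gs hs = 0)
        \<longrightarrow> (\<exists>b. (\<forall>gs hs. \<bar>b gs hs\<bar> \<le> B') \<and> biinvariant b \<and> (\<forall>gs hs. length gs \<le> 1 \<longrightarrow> b gs hs = 0) \<and>
             (\<forall>gs hs. 2 \<le> length gs \<longrightarrow> length gs \<le> Suc (n - 1) \<longrightarrow> 2 \<le> length hs \<longrightarrow> length gs + length hs = n + 2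
                \<longrightarrow> f gs hs = tcodiff b gs hs))"
        by blast
      let ?N1 = "\<lambda>m. real m * ez_bound (m - 1) + 1" let ?N2 = "\<lambda>m::nat. 2::real"
      let ?B = "\<bar>cone_bound ?N1 n * B\<bar> + B' + real n * B' + \<bar>cone_bound ?N2 n * B\<bar>"
      show ?thesis
      proof (intro exI[of _ ?B] allI impI)
        fix c' :: "'a list \<Rightarrow> real"
        assume c'B: "\<forall>xs. \<bar>c' xs\<bar> \<le> B" and c'inv: "invariant c'" and c'co: "\<forall>xs. length xs = n + 2 \<longrightarrow> codiff c' xs = 0"
        \<comment> \<open>After the cut-off \<open>codiff c\<close> is zero on lists of every
          length, so the chain map identities apply without length conditions.\<close>
        define c where "c xs = (if length xs = n + 1 then c' xs else 0)" for xs
        have cB: "\<bar>c xs\<bar> \<le> B" for xs using c'B B0 by (simp add: c_def)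
        have cinv: "invariant c" using c'inv by (simp add: invariant_def c_def)
        have cco: "codiff c = (\<lambda>xs. 0)"
        proof
          fix xs
          show "codiff c xs = 0"
          proof (cases "length xs = n + 2")
            case True
            then have "codiff c xs = codiff c' xs" by (intro codiff_cong) (simp add: c_def)
            then show ?thesis using c'co True by simp
          next
            case False
            then have "codiff c xs = codiff (\<lambda>xs. 0) xs" by (intro codiff_cong) (simp add: c_def)
            then show ?thesis by simp
          qed
        qed
        have crep: "c (map rep xs) = c xs" for xs
        proof -
          have "act \<one> = rep" by (rule ext) (simp add: act_def)
          then show ?thesis using invariantD[OF cinv one_closed, of xs] by simp
        qed

        define c1 where "c1 xs = L (\<lambda>S. c (map (ev S) xs))" for xs
        have c1B: "\<bar>c1 xs\<bar> \<le> B" for xs unfolding c1_def by (rule L_bound) (rule cB)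
        have c1co: "codiff c1 = (\<lambda>xs. 0)"
        proof
          fix xs
          have "codiff c1 xs = L (\<lambda>S. codiff (\<lambda>ys. c (map (ev S) ys)) xs)"
            unfolding c1_def by (rule L_codiff) (rule cB)
          also have "\<dots> = 0" by (simp add: cco L_const flip: codiff_map)
          finally show "codiff c1 xs = 0" .
        qed
        \<comment> \<open>For large \<open>S\<close> the action of \<open>g\<close> on the first
          factor becomes left multiplication by \<iota>(g), under which \<open>c\<close> is
          invariant.\<close>
        have c1left: "c1 (map (map_prod (act g) id) xs) = c1 xs" if g: "g \<in> carrier G" for g xs
          unfolding c1_def
        proof (rule L_cong, rule evF[of "insert g (rep ` fst ` set xs)"])
          fix S assume S: "finite S" "S \<subseteq> carrier G" "insert g (rep ` fst ` set xs) \<subseteq> S"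
          have "map (ev S) (map (map_prod (act g) id) xs) = map (act (\<iota> S g)) (map (ev S) xs)"
          proof (simp, intro ballI)
            fix z assume "z \<in> set xs"
            then have "rep (fst z) \<in> S" "g \<in> S" using S by auto
            then show "ev S (map_prod (act g) id z) = act (\<iota> S g) (ev S z)"
              using S g evc[of S z] \<iota>c by (simp add: ev_def act_def \<iota>m m_assoc)
          qed
          then show "c (map (ev S) (map (map_prod (act g) id) xs)) = c (map (ev S) xs)"
            by (simp only: invariantD[OF cinv \<iota>c])
        qed (use g in auto)
        \<comment> \<open>Here \<open>g\<close> has to be moved to the front past \<iota>(x); this
          is where the commutation is used.\<close>
        have c1right: "c1 (map (map_prod id (act g)) xs) = c1 xs" if g: "g \<in> carrier G" for g xs
          unfolding c1_def
        proof (rule L_cong, rule evF[of "insert g (rep ` fst ` set xs)"])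
          fix S assume S: "finite S" "S \<subseteq> carrier G" "insert g (rep ` fst ` set xs) \<subseteq> S"
          have "map (ev S) (map (map_prod id (act g)) xs) = map (act g) (map (ev S) xs)"
          proof (simp, intro ballI)
            fix z assume "z \<in> set xs"
            then have z: "rep (fst z) \<in> S" "g \<in> S" using S by auto
            then show "ev S (map_prod id (act g) z) = act g (ev S z)"
              using S g evc[of S z] \<iota>c comm[OF S(1,2) z] by (simp add: ev_def act_def flip: m_assoc)
          qed
          then show "c (map (ev S) (map (map_prod id (act g)) xs)) = c (map (ev S) xs)"
            by (simp only: invariantD[OF cinv g])
        qed (use g in auto)
        have c1diag: "c1 (map (map_prod (act g) (act g)) xs) = c1 xs" if g: "g \<in> carrier G" for g xs
        proof -
          have "map (map_prod (act g) (act g)) xs = map (map_prod (act g) id) (map (map_prod id (act g)) xs)"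
            by (simp add: map_prod_def case_prod_beta)
          then show ?thesis by (simp only: c1left[OF g] c1right[OF g])
        qed

        \<comment> \<open>Zero on empty lists, where \<open>ez_map\<close> does not apply; this
          makes the biinvariance unconditional.\<close>
        define f where "f gs hs = (if gs = [] \<or> hs = [] then 0 else ez n c1 gs hs)" for gs hs
        have fB: "\<bar>f gs hs\<bar> \<le> ez_bound n * B" if "gs \<noteq> []" "hs \<noteq> []" "length gs + length hs = n + 2" for gs hs
          using abs_ez_le[OF c1B that] that by (simp add: f_def)
        have finv: "biinvariant f"
          unfolding biinvariant_def
        proof (intro ballI allI conjI)
          fix g gs hs assume g: "g \<in> carrier G"
          show "f (map (act g) gs) hs = f gs hs"
            using ez_map[of gs hs n c1 "act g" id] c1left[OF g] by (auto simp: f_def)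
          show "f gs (map (act g) hs) = f gs hs"
            using ez_map[of gs hs n c1 id "act g"] c1right[OF g] by (auto simp: f_def)
        qed
        have fco: "tcodiff f gs hs = 0" if "gs \<noteq> []" "hs \<noteq> []" "length gs + length hs = n + 3" for gs hs
        proof -
          have "tcodiff f gs hs = tcodiff (ez n c1) gs hs"
            by (rule tcodiff_cong) (use that in \<open>auto simp: f_def\<close>)
          also have "\<dots> = ez (Suc n) (codiff c1) gs hs" using that by (rule ez_codiff[symmetric])
          also have "\<dots> = 0" using ez_diff[of "Suc n" "\<lambda>_. 0" "\<lambda>_. 0" gs hs] by (simp add: c1co del: ez.simps)
          finally show ?thesis .
        qed
        from B'[rule_format, OF fB finv fco]
        obtain b where bB: "\<And>gs hs. \<bar>b gs hs\<bar> \<le> B'" and binv: "biinvariant b"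
          and b1: "\<And>gs hs. length gs \<le> 1 \<Longrightarrow> b gs hs = 0"
          and bf: "\<And>gs hs. 2 \<le> length gs \<Longrightarrow> length gs \<le> Suc (n - 1) \<Longrightarrow> 2 \<le> length hs \<Longrightarrow> length gs + length hs = n + 2
                \<Longrightarrow> f gs hs = tcodiff b gs hs"
          by blast

        define D1 where "D1 = cone_htp diag_htp_map (\<lambda>x. (x, x)) n c1"
        \<comment> \<open>The case distinction stays inside the limit, since \<open>L_codiff\<close>
          needs one bound for all lists and \<open>D2\<close> is bounded on length \<open>n\<close>
          only.\<close>
        define k where "k xs = L (\<lambda>S. if length xs = n then D2 c S (map (\<Phi> S) xs) else 0)" for xs
        have D1: "aw f xs = c1 (map (\<lambda>x. (x, x)) xs) + codiff D1 xs" if "length xs = Suc n" for xs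
        proof -
          have "cone_htp diag_htp_map (\<lambda>x. (x, x)) (Suc n) (codiff c1) xs = 0"
            unfolding c1co by (rule cone_htp_zero) (rule diag_htp_map_diff)
          then have "diag_htp_map c1 xs = codiff D1 xs"
            using cone_htp_codiff[of diag_htp_map xs n "\<lambda>x. (x, x)" c1] that
            by (simp add: diag_htp_map_diff diag_htp_map_codiff D1_def)
          moreover have "aw f xs = aw (ez n c1) xs"
            by (rule aw_cong) (simp add: f_def)
          moreover have "length xs - 1 = n" "xs \<noteq> []" using that by auto
          ultimately show ?thesis by (simp add: diag_htp_map_def)
        qed
        have P2B: "\<bar>P2 S d ys\<bar> \<le> 2 * C" if "\<And>ys. \<bar>d ys\<bar> \<le> C" for S d C ys
          unfolding P2_def using that[of ys] that[of "map (\<lambda>y. rep y \<otimes> \<gamma> S) ys"] by linarith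
        have D2B: "\<bar>D2 c S ys\<bar> \<le> cone_bound ?N2 n * B" if "length ys = n" for S ys
          unfolding D2_def by (rule abs_cone_htp_le[where N = ?N2, OF P2B cB that])
        have D2: "c (map (\<lambda>y. rep y \<otimes> \<gamma> S) ys) - c ys = codiff (D2 c S) ys" if "length ys = Suc n" for S ys
        proof -
          have "cone_htp (P2 S) id (Suc n) (codiff c) ys = 0"
            unfolding cco by (rule cone_htp_zero) (simp add: P2_def)
          moreover have "cone_htp (P2 S) id (Suc n) (codiff c) ys = P2 S c ys - codiff (cone_htp (P2 S) id n c) ys"
            by (rule cone_htp_codiff[OF _ _ _ that])
               (simp_all add: P2_def[abs_def] codiff_diff codiff_map)
          ultimately show ?thesis by (simp add: P2_def D2_def)
        qed
        have D2inv: "D2 c S (map (act g) ys) = D2 c S ys" if g: "g \<in> carrier G" and "length ys = n" for S g ys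
        proof -
          have "D2 c S (map (act g) ys) = cone_htp (P2 S) id n (\<lambda>ys. c (map (act g) ys)) ys"
            unfolding D2_def
          proof (rule cone_htp_map[OF _ _ that(2)])
            show "P2 S d (map (act g) xs) = P2 S (\<lambda>ys. d (map (act g) ys)) xs" for d xs
              using g \<gamma>c by (simp add: P2_def comp_def act_def m_assoc)
          qed simp
          then show ?thesis by (simp add: D2_def invariantD[OF cinv g])
        qed
        have D2B': "\<bar>if length ys = n then D2 c S (map (\<Phi> S) ys) else 0\<bar> \<le> \<bar>cone_bound ?N2 n * B\<bar>" for S ys
        proof (cases "length ys = n")
          case True
          then have "\<bar>D2 c S (map (\<Phi> S) ys)\<bar> \<le> cone_bound ?N2 n * B" by (intro D2B) simp
          also have "\<dots> \<le> \<bar>cone_bound ?N2 n * B\<bar>" by (rule abs_ge_self)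
          finally show ?thesis using True by simp
        qed simp
        have kB: "\<bar>k xs\<bar> \<le> \<bar>cone_bound ?N2 n * B\<bar>" for xs
          unfolding k_def by (rule L_bound) (rule D2B')
        have kco: "L (\<lambda>S. c (map (\<lambda>x. \<iota> S (rep x)) xs)) - L (\<lambda>S. c (map (\<Phi> S) xs)) = codiff k xs"
          if len: "length xs = Suc n" for xs
        proof -
          have "c (map (\<lambda>x. \<iota> S (rep x)) xs) - c (map (\<Phi> S) xs)
             = codiff (\<lambda>ys. if length ys = n then D2 c S (map (\<Phi> S) ys) else 0) xs" for S
          proof -
            have "map (\<lambda>x. \<iota> S (rep x)) xs = map (act (inv \<gamma> S)) (map (\<lambda>y. rep y \<otimes> \<gamma> S) (map (\<Phi> S) xs))"
              using \<phi>c \<gamma>c by (simp add: \<iota>_def \<Phi>_def act_def m_assoc)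
            then have "c (map (\<lambda>x. \<iota> S (rep x)) xs) = c (map (\<lambda>y. rep y \<otimes> \<gamma> S) (map (\<Phi> S) xs))"
              by (simp only: invariantD[OF cinv inv_closed[OF \<gamma>c]])
            then have "c (map (\<lambda>x. \<iota> S (rep x)) xs) - c (map (\<Phi> S) xs) = codiff (D2 c S) (map (\<Phi> S) xs)"
              using D2[of "map (\<Phi> S) xs" S] len by simp
            also have "\<dots> = codiff (\<lambda>ys. D2 c S (map (\<Phi> S) ys)) xs" by (rule codiff_map)
            also have "\<dots> = codiff (\<lambda>ys. if length ys = n then D2 c S (map (\<Phi> S) ys) else 0) xs"
              by (rule codiff_cong) (use len in simp)
            finally show ?thesis .
          qed
          note eq = this
          have "L (\<lambda>S. c (map (\<lambda>x. \<iota> S (rep x)) xs)) - L (\<lambda>S. c (map (\<Phi> S) xs))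
             = L (\<lambda>S. c (map (\<lambda>x. \<iota> S (rep x)) xs) - c (map (\<Phi> S) xs))"
            by (rule L_diff[symmetric, of _ B _ B]) (rule cB)+
          also have "\<dots> = codiff k xs"
            unfolding eq k_def by (rule L_codiff[symmetric, of _ "\<bar>cone_bound ?N2 n * B\<bar>"]) (rule D2B')
          finally show ?thesis .
        qed
        have kinv: "k (map (act g) xs) = k xs" if g: "g \<in> carrier G" for g xs
          unfolding k_def
        proof (rule L_cong, rule evF[of "insert g (rep ` set xs)"])
          fix S assume S: "finite S" "S \<subseteq> carrier G" "insert g (rep ` set xs) \<subseteq> S"
          have "map (\<Phi> S) (map (act g) xs) = map (act (\<phi> S g)) (map (\<Phi> S) xs)"
            using S g \<phi>c \<phi>m[OF S(1,2)] by (auto simp: \<Phi>_def act_def)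
          then show "(if length (map (act g) xs) = n then D2 c S (map (\<Phi> S) (map (act g) xs)) else 0)
            = (if length xs = n then D2 c S (map (\<Phi> S) xs) else 0)"
            by (cases "length xs = n") (simp_all only: length_map D2inv[OF \<phi>c] if_True if_False simp_thms)
        qed (use g in auto)

        \<comment> \<open>Evaluate \<open>f - tcodiff b\<close> on the diagonal in two ways. By the
          homotopy \<open>D1\<close> it is the pullback along \<phi>, up to coboundaries. By
          \<open>aw_eq_ends\<close> it is \<open>c\<close> plus the pullback along \<iota>, up to a
          coboundary. The two pullbacks differ by the coboundary of \<open>k\<close>, so
          \<open>c\<close> alone remains.\<close>
        have main: "c xs = codiff (\<lambda>ys. D1 ys + b ys [\<one>] - aw b ys - k ys) xs" if len: "length xs = Suc n" for xs
        proof -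
          have ne: "xs \<noteq> []" "length xs \<ge> 2" using len n by auto
          have "aw (\<lambda>gs hs. f gs hs - tcodiff b gs hs) xs
             = (f [hd xs] xs - tcodiff b [hd xs] xs) + (f xs [last xs] - tcodiff b xs [last xs])"
            by (rule aw_eq_ends) (use ne len bf in auto)
          \<comment> \<open>Since \<open>b\<close> vanishes when its first variable is a point, the
            correction leaves the summand \<open>c\<close> untouched.\<close>
          moreover have "tcodiff b [hd xs] xs = 0"
          proof -
            have "b [hd xs] = (\<lambda>_. 0)" by (rule ext, rule b1) simp
            then show ?thesis by (simp add: tcodiff_def rcodiff_def)
          qed
          moreover have "tcodiff b xs [last xs] = codiff (\<lambda>ys. b ys [\<one>]) xs"
            using ne biinvariant_singleton(2)[OF binv, of _ "last xs"] by (simp add: tcodiff_def rcodiff_def)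
          moreover have "f [hd xs] xs = c xs"
          proof -
            have "f [hd xs] xs = c1 (map (Pair (hd xs)) xs)"
              using ne by (simp add: f_def ez_edge edge_path_def)
            also have "\<dots> = c1 (map (map_prod (act (inv (rep (hd xs)))) id) (map (Pair (hd xs)) xs))"
              by (rule c1left[symmetric]) simp
            also have "\<dots> = L (\<lambda>S. c (map rep xs))"
              by (simp add: c1_def comp_def ev_def \<iota>1)
            finally show ?thesis by (simp add: L_const crep)
          qed
          moreover have "f xs [last xs] = L (\<lambda>S. c (map (\<lambda>x. \<iota> S (rep x)) xs))"
          proof -
            have "f xs [last xs] = c1 (map (\<lambda>x. (x, last xs)) xs)"
              using ne by (simp add: f_def ez_edge edge_path_def)
            also have "\<dots> = c1 (map (map_prod id (act (inv (rep (last xs))))) (map (\<lambda>x. (x, last xs)) xs))"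
              by (rule c1right[symmetric]) simp
            also have "\<dots> = L (\<lambda>S. c (map (\<lambda>x. \<iota> S (rep x)) xs))"
              by (simp add: c1_def comp_def ev_def \<iota>c)
            finally show ?thesis .
          qed
          moreover have "c1 (map (\<lambda>x. (x, x)) xs) = L (\<lambda>S. c (map (\<Phi> S) xs))"
            unfolding c1_def
          proof (rule L_cong, rule evF[of "rep ` set xs"])
            fix S assume S: "finite S" "S \<subseteq> carrier G" "rep ` set xs \<subseteq> S"
            then have "map (ev S) (map (\<lambda>x. (x, x)) xs) = map (\<Phi> S) xs"
              using \<phi>eq[OF S(1,2)] by (auto simp: ev_def \<Phi>_def)
            then show "c (map (ev S) (map (\<lambda>x. (x, x)) xs)) = c (map (\<Phi> S) xs)" by (simp only:)
          qed auto
          ultimately show ?thesis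
            using D1[OF len] kco[OF len] by (simp add: aw_diff aw_tcodiff codiff_add codiff_diff)
        qed

        define w where "w ys = (if length ys = n then D1 ys + b ys [\<one>] - aw b ys - k ys else 0)" for ys
        show "\<exists>b. (\<forall>xs. \<bar>b xs\<bar> \<le> \<bar>cone_bound ?N1 n * B\<bar> + B' + real n * B' + \<bar>cone_bound ?N2 n * B\<bar>) \<and> invariant b \<and> (\<forall>xs. length xs = n + 1 \<longrightarrow> codiff b xs = c' xs)"
        proof (intro exI[of _ w] conjI allI impI)
          fix xs
          have "\<bar>D1 xs\<bar> \<le> cone_bound ?N1 n * B" if "length xs = n"
            unfolding D1_def by (rule abs_cone_htp_le[where N = ?N1, OF abs_diag_htp_map_le c1B that])
          moreover have "\<bar>aw b xs\<bar> \<le> real n * B'" if "length xs = n"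
            using abs_aw_le[of xs b B'] bB that by simp
          ultimately show "\<bar>w xs\<bar> \<le> \<bar>cone_bound ?N1 n * B\<bar> + B' + real n * B' + \<bar>cone_bound ?N2 n * B\<bar>"
            using bB[of xs "[\<one>]"] kB[of xs] B'0 by (auto simp: w_def)
        next
          have D1inv: "D1 (map (act g) xs) = D1 xs" if g: "g \<in> carrier G" and len: "length xs = n" for g xs
            unfolding D1_def
            by (subst cone_htp_map[where b = "map_prod (act g) (act g)"])
               (simp_all add: diag_htp_map_map c1diag[OF g] len)
          have "aw b (map (act g) xs) = aw b xs" if "g \<in> carrier G" for g xs
            by (simp add: aw_map biinvariantD[OF binv that])
          then show "invariant w"
            by (simp add: invariant_def w_def D1inv kinv biinvariantD[OF binv])
        next
          fix xs :: "'a list" assume len: "length xs = n + 1"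
          have "codiff w xs = codiff (\<lambda>ys. D1 ys + b ys [\<one>] - aw b ys - k ys) xs"
            by (rule codiff_cong) (use len in \<open>simp add: w_def\<close>)
          then show "codiff w xs = c' xs" using main[of xs] len by (simp add: c_def)
        qed
      qed
    qed
  qed
qed

lemma binate_bc_vanishes:
  assumes "binate G" "1 \<le> n"
  shows "bc_vanishes n"
  using assms(2)
proof (induction n rule: less_induct)
  case (less n)
  then show ?case using bc_vanishes_step[OF assms(1)] by blast
qed

end

section \<open>Comparison with the invariant cochain complex\<close>

lemma (in comm_group) trivial_group_Mod_carrier: "trivial_group (G Mod carrier G)"
proof -
  have sub: "subgroup (carrier G) G" by (rule subgroup_self)
  have "carrier (G Mod carrier G) = {\<one>\<^bsub>G Mod carrier G\<^esub>}"
    unfolding carrier_FactGroup one_FactGroup using coset_join2[OF _ sub] by auto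
  moreover have "group (G Mod carrier G)"
    using normal.factorgroup_is_group[OF subgroup_imp_normal[OF sub]] .
  ultimately show ?thesis by (simp add: trivial_group_def)
qed

lemma coboundary_eq_codiff: "gs \<in> tuples G (n + 2) \<Longrightarrow> coboundary G n f gs = codiff f gs"
proof -
  assume gs: "gs \<in> tuples G (n + 2)"
  then have "{..n + 1} = {..<length gs}" by (auto simp: tuples_def)
  then show ?thesis using gs by (simp add: coboundary_def codiff_eq_sum)
qed

lemma coboundary_extensional: "coboundary G n f \<in> extensional (tuples G (n + 2))"
  by (simp add: coboundary_def)

context group
begin

lemma map_tuples [simp]:
  "gs \<in> tuples G m \<Longrightarrow> g \<in> carrier G \<Longrightarrow> map (\<lambda>x. g \<otimes> x) gs \<in> tuples G m"
  by (auto simp: tuples_def)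

lemma map_rep_tuples [simp]: "length gs = m \<Longrightarrow> map rep gs \<in> tuples G m"
  by (auto simp: tuples_def)

lemma invariant_bounded_cochains_iff:
  "f \<in> invariant_bounded_cochains G n \<longleftrightarrow> f \<in> extensional (tuples G (n + 1)) \<and>
     (\<exists>B. \<forall>gs\<in>tuples G (n + 1). \<bar>f gs\<bar> \<le> B) \<and>
     (\<forall>g\<in>carrier G. \<forall>gs\<in>tuples G (n + 1). f (map (\<lambda>x. g \<otimes> x) gs) = f gs)"
proof -
  have "(\<forall>g\<in>carrier G. cochain_action G n g f = f) \<longleftrightarrow>
     (\<forall>g\<in>carrier G. \<forall>gs\<in>tuples G (n + 1). f (map (\<lambda>x. g \<otimes> x) gs) = f gs)"
    if ext: "f \<in> extensional (tuples G (n + 1))"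
  proof (intro iffI ballI)
    fix g gs assume *: "\<forall>g\<in>carrier G. cochain_action G n g f = f" "g \<in> carrier G" "gs \<in> tuples G (n + 1)"
    then have "cochain_action G n (inv g) f gs = f gs" by simp
    then show "f (map (\<lambda>x. g \<otimes> x) gs) = f gs" using * by (simp add: cochain_action_def)
  next
    fix g assume *: "\<forall>g\<in>carrier G. \<forall>gs\<in>tuples G (n + 1). f (map (\<lambda>x. g \<otimes> x) gs) = f gs" "g \<in> carrier G"
    show "cochain_action G n g f = f"
      by (rule extensionalityI[OF _ ext]) (use * in \<open>auto simp: cochain_action_def\<close>)
  qed
  then show ?thesis
    unfolding invariant_bounded_cochains_def bounded_cochains_def bounded_iff by auto
qed

lemma bounded_cocycles_iff:
  "f \<in> carrier (bounded_cocycles G n) \<longleftrightarrow> f \<in> invariant_bounded_cochains G n \<and>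
     (\<forall>gs\<in>tuples G (n + 2). codiff f gs = 0)"
proof -
  have "coboundary G n f = zero_cochain G (n + 1) \<longleftrightarrow> (\<forall>gs\<in>tuples G (n + 2). codiff f gs = 0)"
  proof
    assume eq: "coboundary G n f = zero_cochain G (n + 1)"
    show "\<forall>gs\<in>tuples G (n + 2). codiff f gs = 0"
    proof
      fix gs assume gs: "gs \<in> tuples G (n + 2)"
      then show "codiff f gs = 0"
        using coboundary_eq_codiff[OF gs, of f] by (simp add: eq zero_cochain_def)
    qed
  next
    assume eq: "\<forall>gs\<in>tuples G (n + 2). codiff f gs = 0"
    show "coboundary G n f = zero_cochain G (n + 1)"
      by (rule extensionalityI[OF coboundary_extensional]) (use eq in \<open>auto simp: zero_cochain_def coboundary_eq_codiff\<close>)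
  qed
  then show ?thesis by (simp add: bounded_cocycles_def)
qed

lemma codiff_restrict:
  assumes "gs \<in> tuples G (n + 2)"
  shows "codiff (restrict f (tuples G (n + 1))) gs = codiff f gs"
  by (rule codiff_cong_set) (use assms in \<open>auto simp: tuples_def\<close>)

lemma comm_group_bounded_cocycles: "comm_group (bounded_cocycles G n)"
proof (rule comm_groupI)
  let ?Z = "bounded_cocycles G n" and ?T = "tuples G (n + 1)"
  have mult: "f \<otimes>\<^bsub>?Z\<^esub> f' = (\<lambda>gs\<in>?T. f gs + f' gs)" for f f'
    by (simp add: bounded_cocycles_def)
  have one: "\<one>\<^bsub>?Z\<^esub> = (\<lambda>gs\<in>?T. 0)" by (simp add: bounded_cocycles_def zero_cochain_def)
  have ext: "f \<in> extensional ?T" if "f \<in> carrier ?Z" for f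
    using that by (simp add: bounded_cocycles_iff invariant_bounded_cochains_iff)
  \<comment> \<open>One closure property for both purposes: \<open>r = 1\<close> gives sums, and
    \<open>r = -1\<close> with first summand zero gives inverses.\<close>
  have comb: "(\<lambda>gs\<in>?T. f gs + r * f' gs) \<in> carrier ?Z" if f: "f \<in> carrier ?Z" "f' \<in> carrier ?Z" for f f' r
  proof -
    obtain B B' where "\<forall>gs\<in>?T. \<bar>f gs\<bar> \<le> B" "\<forall>gs\<in>?T. \<bar>f' gs\<bar> \<le> B'"
      using f by (auto simp: bounded_cocycles_iff invariant_bounded_cochains_iff)
    then have "\<forall>gs\<in>?T. \<bar>f gs + r * f' gs\<bar> \<le> B + \<bar>r\<bar> * B'"
      by (auto simp: abs_mult intro!: order_trans[OF abs_triangle_ineq] add_mono mult_left_mono)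
    then show ?thesis
      using f by (auto simp: bounded_cocycles_iff invariant_bounded_cochains_iff codiff_restrict[simplified] codiff_add codiff_cmult
          simp del: restrict_apply simp: restrict_apply')
  qed
  have zero: "(\<lambda>gs\<in>?T. 0) \<in> carrier ?Z"
    by (auto simp: bounded_cocycles_iff invariant_bounded_cochains_iff codiff_restrict[simplified] restrict_apply' simp del: restrict_apply)
  show "\<one>\<^bsub>?Z\<^esub> \<in> carrier ?Z" using zero by (simp only: one)
  show "f \<otimes>\<^bsub>?Z\<^esub> f' \<in> carrier ?Z" if "f \<in> carrier ?Z" "f' \<in> carrier ?Z" for f f'
    using comb[OF that, of 1] by (simp add: mult)
  show "f \<otimes>\<^bsub>?Z\<^esub> f' \<otimes>\<^bsub>?Z\<^esub> f'' = f \<otimes>\<^bsub>?Z\<^esub> (f' \<otimes>\<^bsub>?Z\<^esub> f'')" for f f' f''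
    by (auto simp: mult fun_eq_iff)
  show "f \<otimes>\<^bsub>?Z\<^esub> f' = f' \<otimes>\<^bsub>?Z\<^esub> f" for f f'
    by (auto simp: mult fun_eq_iff)
  show "\<one>\<^bsub>?Z\<^esub> \<otimes>\<^bsub>?Z\<^esub> f = f" if "f \<in> carrier ?Z" for f
    by (rule extensionalityI[OF _ ext[OF that]]) (auto simp: mult one)
  show "\<exists>f'\<in>carrier ?Z. f' \<otimes>\<^bsub>?Z\<^esub> f = \<one>\<^bsub>?Z\<^esub>" if f: "f \<in> carrier ?Z" for f
    by (intro bexI[OF _ comb[OF zero f, of "-1"]]) (auto simp: mult one fun_eq_iff)
qed

lemma coboundary_in_cocycles:
  assumes "f \<in> invariant_bounded_cochains G n"
  shows "coboundary G n f \<in> carrier (bounded_cocycles G (Suc n))"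
proof -
  have f: "f \<in> extensional (tuples G (n + 1))"
     "\<And>g gs. g \<in> carrier G \<Longrightarrow> gs \<in> tuples G (n + 1) \<Longrightarrow> f (map (\<lambda>x. g \<otimes> x) gs) = f gs"
    using assms by (auto simp: invariant_bounded_cochains_iff)
  obtain B where B: "\<And>gs. gs \<in> tuples G (n + 1) \<Longrightarrow> \<bar>f gs\<bar> \<le> B"
    using assms by (auto simp: invariant_bounded_cochains_iff)
  show ?thesis
    unfolding bounded_cocycles_iff invariant_bounded_cochains_iff
  proof (intro conjI ballI exI)
    show "coboundary G n f \<in> extensional (tuples G (Suc n + 1))"
      using coboundary_extensional[of G n f] by simp
    fix gs assume gs: "gs \<in> tuples G (Suc n + 1)"
    then have gs': "gs \<in> tuples G (n + 2)" by simp
    \<comment> \<open>Extended by zero, because \<open>abs_codiff_le\<close> asks for a bound on all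
      lists of the given length.\<close>
    let ?f = "\<lambda>ys. if ys \<in> tuples G (n + 1) then f ys else 0"
    have "coboundary G n f gs = codiff ?f gs"
      unfolding coboundary_eq_codiff[OF gs'] by (rule codiff_cong_set) (use gs in \<open>auto simp: tuples_def\<close>)
    also have "\<bar>\<dots>\<bar> \<le> real (length gs) * \<bar>B\<bar>"
      by (rule abs_codiff_le) (use B in \<open>fastforce intro: order_trans\<close>)
    finally show "\<bar>coboundary G n f gs\<bar> \<le> real (n + 2) * \<bar>B\<bar>" using gs by (simp add: tuples_def)
    fix g assume g: "g \<in> carrier G"
    have "codiff f (map (\<lambda>x. g \<otimes> x) gs) = codiff f gs"
      unfolding codiff_map by (rule codiff_cong_set, rule f(2)[OF g]) (use gs in \<open>auto simp: tuples_def\<close>)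
    then show "coboundary G n f (map (\<lambda>x. g \<otimes> x) gs) = coboundary G n f gs"
      using gs' g by (simp add: coboundary_eq_codiff)
  next
    fix gs assume gs: "gs \<in> tuples G (Suc n + 2)"
    have "codiff (coboundary G n f) gs = codiff (codiff f) gs"
      by (rule codiff_cong_set, rule coboundary_eq_codiff) (use gs in \<open>auto simp: tuples_def\<close>)
    then show "codiff (coboundary G n f) gs = 0" by (simp add: codiff_codiff)
  qed
qed

text \<open>Precomposing with \<open>rep\<close> turns \<open>f\<close> into a cocycle on all lists;
  its primitive is then restricted to tuples, where \<open>rep\<close> is the identity.\<close>

lemma bc_vanishes_imp_coboundary:
  assumes van: "bc_vanishes (Suc m)" and f: "f \<in> carrier (bounded_cocycles G (Suc m))"
  shows "f \<in> coboundary G m ` invariant_bounded_cochains G m"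
proof -
  let ?T = "tuples G (m + 2)"
  have ext: "f \<in> extensional ?T"
    and finv: "\<And>g gs. g \<in> carrier G \<Longrightarrow> gs \<in> ?T \<Longrightarrow> f (map (\<lambda>x. g \<otimes> x) gs) = f gs"
    and fco: "\<And>gs. gs \<in> tuples G (m + 3) \<Longrightarrow> codiff f gs = 0"
    using f by (auto simp: bounded_cocycles_iff invariant_bounded_cochains_iff numeral_2_eq_2 numeral_3_eq_3)
  obtain B where B: "\<And>gs. gs \<in> ?T \<Longrightarrow> \<bar>f gs\<bar> \<le> B"
    using f by (auto simp: bounded_cocycles_iff invariant_bounded_cochains_iff)
  define c where "c gs = (if length gs = m + 2 then f (map rep gs) else 0)" for gs
  have rep_act: "map rep (map (act g) gs) = map (\<lambda>x. g \<otimes> x) (map rep gs)" if "g \<in> carrier G" for g gs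
    using that by (simp add: act_def)
  from van obtain B' where B': "\<forall>c. (\<forall>xs. \<bar>c xs\<bar> \<le> \<bar>B\<bar>) \<longrightarrow> invariant c \<longrightarrow>
     (\<forall>xs. length xs = Suc m + 2 \<longrightarrow> codiff c xs = 0) \<longrightarrow>
     (\<exists>b. (\<forall>xs. \<bar>b xs\<bar> \<le> B') \<and> invariant b \<and> (\<forall>xs. length xs = Suc m + 1 \<longrightarrow> codiff b xs = c xs))"
    unfolding bc_vanishes_def by blast
  have "\<exists>b. (\<forall>xs. \<bar>b xs\<bar> \<le> B') \<and> invariant b \<and> (\<forall>xs. length xs = Suc m + 1 \<longrightarrow> codiff b xs = c xs)"
  proof (rule B'[rule_format])
    show "\<bar>c xs\<bar> \<le> \<bar>B\<bar>" for xs
      using B[of "map rep xs"] by (auto simp: c_def intro: order_trans)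
    show "invariant c"
      unfolding invariant_def c_def using finv by (auto simp: rep_act simp del: map_map)
    fix xs :: "'a list" assume len: "length xs = Suc m + 2"
    have "codiff c xs = codiff (\<lambda>ys. f (map rep ys)) xs"
      by (rule codiff_cong) (use len in \<open>simp add: c_def\<close>)
    then show "codiff c xs = 0" using fco[of "map rep xs"] len by (simp add: codiff_map)
  qed
  then obtain b where b: "\<And>xs. \<bar>b xs\<bar> \<le> B'" "invariant b" "\<And>xs. length xs = m + 2 \<Longrightarrow> codiff b xs = c xs"
    by auto
  let ?b = "restrict b (tuples G (m + 1))"
  have "?b \<in> invariant_bounded_cochains G m"
    unfolding invariant_bounded_cochains_iff
  proof (intro conjI ballI exI)
    show "\<bar>?b gs\<bar> \<le> B'" if "gs \<in> tuples G (m + 1)" for gs using b(1) that by simp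
    fix g gs assume *: "g \<in> carrier G" "gs \<in> tuples G (m + 1)"
    have "map (act g) gs = map (\<lambda>x. g \<otimes> x) gs" using * by (auto simp: tuples_def act_def)
    then show "?b (map (\<lambda>x. g \<otimes> x) gs) = ?b gs"
      using invariantD[OF b(2), of g gs] * by (simp del: map_eq_conv)
  qed simp
  moreover have "coboundary G m ?b = f"
  proof (rule extensionalityI[OF coboundary_extensional ext])
    fix gs assume gs: "gs \<in> ?T"
    have "map rep gs = gs" using gs by (intro map_idI) (auto simp: tuples_def)
    then have "c gs = f gs" using gs by (simp add: c_def tuples_def)
    then show "coboundary G m ?b gs = f gs"
      using b(3)[of gs] gs unfolding coboundary_eq_codiff[OF gs] codiff_restrict[OF gs]
      by (simp add: tuples_def)
  qed
  ultimately show ?thesis by blast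
qed

theorem binate_imp_boundedly_acyclic:
  assumes "binate G"
  shows "boundedly_acyclic G"
  unfolding boundedly_acyclic_def
proof (intro conjI allI impI)
  show "group G" by (rule is_group)
  fix n :: nat assume "1 \<le> n"
  then obtain m where n: "n = Suc m" by (cases n) auto
  have "bounded_coboundaries G n = carrier (bounded_cocycles G n)"
    using coboundary_in_cocycles bc_vanishes_imp_coboundary[OF binate_bc_vanishes[OF assms]]
    by (auto simp: bounded_coboundaries_def n)
  then show "trivial_group (bounded_cohomology G n)"
    using comm_group.trivial_group_Mod_carrier[OF comm_group_bounded_cocycles]
    by (simp add: bounded_cohomology_def)
qed

end

subsection \<open>Cantor sets\<close>

definition clopenin :: "'a::topological_space set \<Rightarrow> 'a set \<Rightarrow> bool" where
  "clopenin K A \<longleftrightarrow> openin (top_of_set K) A \<and> closedin (top_of_set K) A"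

lemma clopenin_subset: "clopenin K A \<Longrightarrow> A \<subseteq> K"
  by (auto simp: clopenin_def dest: openin_imp_subset)

lemma clopenin_Int: "clopenin K A \<Longrightarrow> clopenin K B \<Longrightarrow> clopenin K (A \<inter> B)"
  by (auto simp: clopenin_def)

lemma clopenin_Un: "clopenin K A \<Longrightarrow> clopenin K B \<Longrightarrow> clopenin K (A \<union> B)"
  by (auto simp: clopenin_def)

lemma clopenin_Diff: "clopenin K A \<Longrightarrow> clopenin K B \<Longrightarrow> clopenin K (A - B)"
  by (auto simp: clopenin_def intro: openin_diff closedin_diff)

lemma clopenin_self [simp]: "clopenin K K"
  by (simp add: clopenin_def)

text \<open>In a compact Hausdorff space, closed sets that no connected set joins can be separated.
  Here connected sets have at most one point, so disjointness is enough.\<close>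

lemma clopen_between:
  fixes K :: "'a::metric_space set"
  assumes "cantor_set K" and S: "closedin (top_of_set K) S" and T: "closedin (top_of_set K) T"
    and ST: "S \<inter> T = {}"
  obtains A where "clopenin K A" "S \<subseteq> A" "A \<inter> T = {}"
proof -
  have "compact_space (top_of_set K)"
    using assms(1) by (simp add: cantor_set_def compact_space_subtopology)
  moreover have "Hausdorff_space (top_of_set K)"
    by (simp add: Hausdorff_space_subtopology)
  moreover have "disjnt C S \<or> disjnt C T" if "connectedin (top_of_set K) C" for C
  proof (rule ccontr)
    assume "\<not> ?thesis"
    then obtain s t where st: "s \<in> C" "s \<in> S" "t \<in> C" "t \<in> T" by (auto simp: disjnt_iff)
    have C: "connected C" "C \<subseteq> K" using that by (auto simp: connectedin_subtopology)
    then have "C \<subseteq> connected_component_set K s" using st by (intro connected_component_maximal) auto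
    also have "\<dots> = {s}" using assms(1) st C by (auto simp: cantor_set_def totally_disconnected_def)
    finally show False using st ST by auto
  qed
  ultimately have "separated_between (top_of_set K) S T"
    using cut_wire_fence_theorem S T by blast
  then obtain U V where UV: "openin (top_of_set K) U" "openin (top_of_set K) V" "U \<union> V = K" "disjnt U V" "S \<subseteq> U" "T \<subseteq> V"
    by (auto simp: separated_between_def)
  have "K - U = V" using UV by (auto simp: disjnt_iff)
  then have "clopenin K U"
    using UV by (auto simp: clopenin_def closedin_def)
  moreover have "U \<inter> T = {}" using UV by (auto simp: disjnt_iff)
  ultimately show ?thesis using that UV by blast
qed

lemma clopen_nbhd:
  fixes K :: "'a::metric_space set"
  assumes "cantor_set K" "openin (top_of_set K) U" "S \<subseteq> U" "finite S"
  obtains A where "clopenin K A" "S \<subseteq> A" "A \<subseteq> U"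
proof -
  have UK: "U \<subseteq> K" using assms(2) by (rule openin_imp_subset)
  have "closedin (top_of_set K) S"
    using assms(3,4) UK by (intro closed_subset finite_imp_closed) auto
  moreover have "closedin (top_of_set K) (K - U)"
    using assms(2) by (simp add: closedin_diff)
  ultimately obtain A where "clopenin K A" "S \<subseteq> A" "A \<inter> (K - U) = {}"
    using clopen_between[OF assms(1), of S "K - U"] assms(3) by blast
  then show ?thesis using that clopenin_subset by blast
qed

text \<open>In a finite open set, removing all points but one would isolate that point.\<close>

lemma cantor_set_open_infinite:
  fixes K :: "'a::metric_space set"
  assumes "cantor_set K" "openin (top_of_set K) U" "U \<noteq> {}"
  shows "infinite U"
proof
  assume fin: "finite U"
  obtain x where x: "x \<in> U" using assms(3) by auto
  obtain T where T: "open T" "U = K \<inter> T" using assms(2) by (auto simp: openin_open)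
  have "open (T - (U - {x}))" using T fin by (intro open_Diff finite_imp_closed) auto
  moreover have "(T - (U - {x})) \<inter> K = {x}" using T x by auto
  ultimately have "x isolated_in K" using x T by (auto simp: isolated_in_def)
  then show False using assms(1) x T by (auto simp: cantor_set_def)
qed

lemma cantor_set_clopenin:
  fixes K :: "'a::metric_space set"
  assumes K: "cantor_set K" and A: "clopenin K A"
  shows "cantor_set A"
  unfolding cantor_set_def
proof (intro conjI ballI)
  have AK: "A \<subseteq> K" using A by (rule clopenin_subset)
  show "compact A"
    using A K by (auto simp: clopenin_def cantor_set_def intro: closedin_compact)
  show "totally_disconnected A"
    unfolding totally_disconnected_def
  proof
    fix x assume x: "x \<in> A"
    have "connected_component_set A x \<subseteq> connected_component_set K x"
      by (rule connected_component_mono[OF AK])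
    also have "\<dots> = {x}" using K x AK by (auto simp: cantor_set_def totally_disconnected_def)
    finally show "connected_component_set A x = {x}" using x by (auto simp: connected_component_refl)
  qed
  fix x assume x: "x \<in> A"
  show "\<not> x isolated_in A"
  proof
    assume "x isolated_in A"
    then obtain T where T: "open T" "T \<inter> A = {x}" by (auto simp: isolated_in_def)
    have "openin (top_of_set K) (T \<inter> A)"
      using A T openin_Int_open[of K A T] by (simp add: clopenin_def Int_commute)
    then show False using cantor_set_open_infinite[OF K] T by fastforce
  qed
qed

text \<open>Take finite covers by clopen sets inside balls of radius \<open>1 / (n + 1)\<close>. Two
  points of such a set are less than twice the radius apart, whence the half of the distance
  below.\<close>

lemma countable_clopen_separating:
  fixes K :: "'a::metric_space set"
  assumes K: "cantor_set K"
  obtains C :: "nat \<Rightarrow> 'a set" where "\<And>n. clopenin K (C n)"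
    "\<And>x y. x \<in> K \<Longrightarrow> y \<in> K \<Longrightarrow> x \<noteq> y \<Longrightarrow> \<exists>n. x \<in> C n \<and> y \<notin> C n"
proof -
  have "\<exists>\<F>. finite \<F> \<and> (\<forall>A\<in>\<F>. clopenin K A \<and> (\<exists>c. A \<subseteq> ball c (inverse (Suc n)))) \<and> K \<subseteq> \<Union>\<F>" for n
  proof -
    let ?\<A> = "{A. clopenin K A \<and> (\<exists>c. A \<subseteq> ball c (inverse (Suc n)))}"
    have "\<exists>A\<in>?\<A>. x \<in> A" if "x \<in> K" for x
    proof -
      define r where "r = inverse (real (Suc n))"
      have "openin (top_of_set K) (K \<inter> ball x r)" by (simp add: openin_open_Int)
      moreover have "{x} \<subseteq> K \<inter> ball x r" using that by (simp add: r_def)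
      ultimately obtain A where "clopenin K A" "{x} \<subseteq> A" "A \<subseteq> K \<inter> ball x r"
        by (rule clopen_nbhd[OF K]) auto
      then show ?thesis unfolding r_def by auto
    qed
    then have "K \<subseteq> \<Union>?\<A>" by blast
    moreover have "openin (top_of_set K) A" if "A \<in> ?\<A>" for A using that by (simp add: clopenin_def)
    moreover have "compactin (top_of_set K) K" using K by (simp add: cantor_set_def compactin_subtopology)
    ultimately obtain \<F> where "finite \<F>" "\<F> \<subseteq> ?\<A>" "K \<subseteq> \<Union>\<F>"
      unfolding compactin_def by (metis (no_types, lifting))
    then show ?thesis by blast
  qed
  then obtain \<F> where \<F>: "\<And>n. finite (\<F> n)" "\<And>n A. A \<in> \<F> n \<Longrightarrow> clopenin K A"
    "\<And>n A. A \<in> \<F> n \<Longrightarrow> \<exists>c. A \<subseteq> ball c (inverse (Suc n))" "\<And>n. K \<subseteq> \<Union>(\<F> n)"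
    by metis
  \<comment> \<open>Inserting \<open>K\<close> keeps the family nonempty, as the enumeration
    requires.\<close>
  define \<G> where "\<G> = insert K (\<Union>n. \<F> n)"
  have cnt: "countable \<G>" "\<G> \<noteq> {}" using \<F>(1) by (auto simp: \<G>_def intro: countable_finite)
  show ?thesis
  proof (rule that[of "from_nat_into \<G>"])
    show "clopenin K (from_nat_into \<G> n)" for n
      using from_nat_into[OF cnt(2), of n] \<F>(2) by (auto simp: \<G>_def)
    fix x y assume xy: "x \<in> K" "y \<in> K" "x \<noteq> y"
    then obtain n where n: "inverse (real (Suc n)) < dist x y / 2"
      using reals_Archimedean[of "dist x y / 2"] by auto
    obtain A where A: "A \<in> \<F> n" "x \<in> A" using \<F>(4) xy(1) by blast
    then obtain c where c: "A \<subseteq> ball c (inverse (Suc n))" using \<F>(3) by blast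
    have "y \<notin> A"
    proof
      assume "y \<in> A"
      then have "dist c x < inverse (Suc n)" "dist c y < inverse (Suc n)" using A c by auto
      then show False using n dist_triangle3[of x y c] by linarith
    qed
    moreover obtain m where "from_nat_into \<G> m = A"
      using from_nat_into_surj[OF cnt(1)] A by (auto simp: \<G>_def)
    ultimately show "\<exists>n. x \<in> from_nat_into \<G> n \<and> y \<notin> from_nat_into \<G> n" using A by blast
  qed
qed

text \<open>Cut \<open>K\<close> successively along a countable family of clopen sets that separates points,
  replacing a cut by an arbitrary nontrivial one whenever it does not split the current piece.\<close>

lemma cantor_set_homeomorphic_bit_sequences:
  fixes K :: "'a::metric_space set"
  assumes K: "cantor_set K" and "K \<noteq> {}"
  shows "K homeomorphic {s :: nat \<Rightarrow> real. \<forall>n. s n \<in> {0, 1}}"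
proof -
  obtain C :: "nat \<Rightarrow> 'a set" where C: "\<And>n. clopenin K (C n)"
    "\<And>x y. x \<in> K \<Longrightarrow> y \<in> K \<Longrightarrow> x \<noteq> y \<Longrightarrow> \<exists>n. x \<in> C n \<and> y \<notin> C n"
    using countable_clopen_separating[OF K] by blast
  \<comment> \<open>\<open>B\<close> is a proper nonempty part, so both halves can be cut again;
    this gives surjectivity. It equals \<open>A \<inter> C n\<close> whenever that is a genuine cut;
    this gives injectivity.\<close>
  have "\<exists>B. clopenin K A \<and> A \<noteq> {} \<longrightarrow> clopenin K B \<and> B \<noteq> {} \<and> B \<subset> A \<and> (A \<inter> C n = {} \<or> A \<subseteq> C n \<or> B = A \<inter> C n)" for n A
  proof (cases "A \<inter> C n = {} \<or> A \<subseteq> C n")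
    case False
    then show ?thesis using clopenin_Int[OF _ C(1)] by (intro exI[of _ "A \<inter> C n"]) auto
  next
    case True
    show ?thesis
    proof (cases "clopenin K A \<and> A \<noteq> {}")
      case clA: True
      then have "infinite A" using cantor_set_open_infinite[OF K] by (simp add: clopenin_def)
      obtain x where x: "x \<in> A" using clA by blast
      have "infinite (A - {x})" using \<open>infinite A\<close> by simp
      then obtain y where y: "y \<in> A" "y \<noteq> x" using infinite_imp_nonempty by blast
      have "x \<in> K" "y \<in> K" using x y clA clopenin_subset by auto
      then obtain m where m: "x \<in> C m" "y \<notin> C m" using C(2) y by metis
      then have "clopenin K (A \<inter> C m) \<and> A \<inter> C m \<noteq> {} \<and> A \<inter> C m \<subset> A"
        using x y clA clopenin_Int[OF _ C(1)] by auto
      then show ?thesis using True by blast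
    qed auto
  qed
  note split = this
  define Lf where "Lf n A = (SOME B. clopenin K A \<and> A \<noteq> {} \<longrightarrow> clopenin K B \<and> B \<noteq> {} \<and> B \<subset> A \<and> (A \<inter> C n = {} \<or> A \<subseteq> C n \<or> B = A \<inter> C n))" for n A
  have Lf: "clopenin K (Lf n A) \<and> Lf n A \<noteq> {} \<and> Lf n A \<subset> A \<and> (A \<inter> C n = {} \<or> A \<subseteq> C n \<or> Lf n A = A \<inter> C n)"
    if "clopenin K A" "A \<noteq> {}" for n A
    by (rule someI_ex[OF split[of A n], folded Lf_def, THEN mp]) (use that in simp)
  define cell where "cell s = rec_nat K (\<lambda>n A. if s n then Lf n A else A - Lf n A)" for s :: "nat \<Rightarrow> bool"
  have cell0: "cell s 0 = K" and cellS: "cell s (Suc n) = (if s n then Lf n (cell s n) else cell s n - Lf n (cell s n))" for s n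
    by (simp_all add: cell_def)
  have cell: "clopenin K (cell s n) \<and> cell s n \<noteq> {}" for s n
  proof (induction n)
    case 0
    then show ?case using assms(2) by (simp add: cell0)
  next
    case (Suc n)
    then show ?case using Lf[of "cell s n" n] by (auto simp: cellS intro: clopenin_Diff)
  qed
  have cell_mono: "cell s (Suc n) \<subseteq> cell s n" for s n
    using Lf[of "cell s n" n] cell[of s n] by (auto simp: cellS)
  \<comment> \<open>The cell of stage \<open>n\<close> around \<open>x\<close>, obtained by
    following the point instead of a bit sequence; \<open>f x\<close> records the choices made on
    the way.\<close>
  define pc where "pc x = rec_nat K (\<lambda>n A. if x \<in> Lf n A then Lf n A else A - Lf n A)" for x
  have pc0: "pc x 0 = K" and pcS: "pc x (Suc n) = (if x \<in> Lf n (pc x n) then Lf n (pc x n) else pc x n - Lf n (pc x n))" for x n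
    by (simp_all add: pc_def)
  define f where "f x n = (x \<in> Lf n (pc x n))" for x n
  have cell_f: "cell (f x) n = pc x n" for x n
    by (induction n) (simp_all add: cell0 cellS pc0 pcS f_def)
  have pc_self: "x \<in> pc x n" if "x \<in> K" for x n
    by (induction n) (use that in \<open>auto simp: pc0 pcS\<close>)
  have pc_sub: "pc x (Suc n) \<subseteq> pc x n" for x n
    using cell_mono[of "f x" n] by (simp add: cell_f)
  have pc_eq: "pc y n = pc x n" if "y \<in> pc x n" for x y n
    using that
  proof (induction n)
    case (Suc n)
    then have "pc y n = pc x n" using pc_sub by blast
    then show ?case using Suc.prems by (auto simp: pcS split: if_splits)
  qed (simp add: pc0)
  have f_loc: "f y n = f x n" if "y \<in> pc x (Suc n)" for x y n
    using that pc_eq[of y x n] pc_sub[of x n] by (auto simp: f_def pcS split: if_splits)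
  define F where "F x n = (of_bool (f x n) :: real)" for x n
  have cont: "continuous_on K F"
  proof (rule continuous_on_coordinatewise_then_product)
    fix n
    show "continuous_on K (\<lambda>x. F x n)"
      unfolding continuous_openin_preimage_eq
    proof (intro allI impI)
      fix T :: "real set"
      have "openin (top_of_set K) (K \<inter> (\<lambda>x. F x n) -` T)"
      proof (subst openin_subopen, intro ballI)
        fix x assume x: "x \<in> K \<inter> (\<lambda>x. F x n) -` T"
        have "openin (top_of_set K) (pc x (Suc n))"
          using cell[of "f x" "Suc n"] by (simp add: cell_f clopenin_def)
        moreover have "pc x (Suc n) \<subseteq> K \<inter> (\<lambda>x. F x n) -` T"
          using f_loc[of _ x n] x clopenin_subset[of K "pc x (Suc n)"] cell[of "f x" "Suc n"]
          by (auto simp: F_def cell_f)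
        ultimately show "\<exists>U. openin (top_of_set K) U \<and> x \<in> U \<and> U \<subseteq> K \<inter> (\<lambda>x. F x n) -` T"
          using pc_self x by blast
      qed
      then show "openin (top_of_set K) (K \<inter> (\<lambda>x. F x n) -` T)" .
    qed
  qed
  \<comment> \<open>Points with the same address share all cells, but at a stage \<open>n\<close>
    where \<open>C n\<close> separates them, their common cell is cut along
    \<open>C n\<close>.\<close>
  have inj: "inj_on f K"
  proof (rule inj_onI, rule ccontr)
    fix x y assume xy: "x \<in> K" "y \<in> K" "f x = f y" "x \<noteq> y"
    then obtain n where n: "x \<in> C n" "y \<notin> C n" using C(2) by blast
    have eq: "pc x m = pc y m" for m using cell_f[of x m] cell_f[of y m] xy(3) by simp
    have "x \<in> pc x n" "y \<in> pc x n" using pc_self xy eq by auto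
    then have "Lf n (pc x n) = pc x n \<inter> C n"
      using Lf[of "pc x n" n] cell[of "f x" n] n by (auto simp: cell_f)
    then have "f x n \<noteq> f y n" using n \<open>x \<in> pc x n\<close> \<open>y \<in> pc x n\<close> eq by (auto simp: f_def)
    then show False using xy by simp
  qed
  \<comment> \<open>The cells of any bit sequence are nested, nonempty and closed, so compactness
    yields a common point.\<close>
  have surj: "f ` K = UNIV"
  proof (intro equalityI subset_UNIV subsetI)
    fix s :: "nat \<Rightarrow> bool"
    have "compact_space (top_of_set K)"
      using K by (simp add: cantor_set_def compact_space_subtopology)
    moreover have "closedin (top_of_set K) (cell s n)" "cell s n \<noteq> {}" for n
      using cell[of s n] by (auto simp: clopenin_def)
    moreover have "decseq (cell s)" using cell_mono by (intro decseq_SucI)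
    ultimately have "(\<Inter>n. cell s n) \<noteq> {}" by (rule compact_space_imp_nest)
    then obtain x where x: "\<And>n. x \<in> cell s n" by auto
    have xK: "x \<in> K" using x[of 0] by (simp add: cell0)
    have pc: "pc x n = cell s n" for n
    proof (induction n)
      case (Suc n)
      then show ?case using x[of "Suc n"] by (auto simp: pcS cellS split: if_splits)
    qed (simp add: pc0 cell0)
    have "f x n = s n" for n using x[of "Suc n"] by (auto simp: f_def pc cellS split: if_splits)
    then have "s = f x" by auto
    then show "s \<in> f ` K" using xK by blast
  qed
  have "inj_on F K"
    using inj by (auto simp: inj_on_def F_def fun_eq_iff)
  moreover have "F ` K = {s. \<forall>n. s n \<in> {0, 1}}"
  proof (intro equalityI subsetI)
    fix s :: "nat \<Rightarrow> real" assume s: "s \<in> {s. \<forall>n. s n \<in> {0, 1}}"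
    have "(\<lambda>n. s n = 1) \<in> f ` K" using surj by simp
    then obtain x where "x \<in> K" "f x = (\<lambda>n. s n = 1)" by auto
    moreover from this s have "s = F x" by (auto simp: F_def fun_eq_iff)
    ultimately show "s \<in> F ` K" by blast
  qed (auto simp: F_def)
  ultimately show ?thesis
    using homeomorphic_compact[OF _ cont] K by (simp add: cantor_set_def)
qed

lemma cantor_sets_homeomorphic:
  fixes A :: "'a::metric_space set" and B :: "'b::metric_space set"
  assumes "cantor_set A" "A \<noteq> {}" "cantor_set B" "B \<noteq> {}"
  shows "A homeomorphic B"
  by (rule homeomorphic_trans[OF cantor_set_homeomorphic_bit_sequences[OF assms(1,2)]
      iffD1[OF homeomorphic_sym cantor_set_homeomorphic_bit_sequences[OF assms(3,4)]]])

section \<open>Homeomorphisms that permute blocks\<close>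

text \<open>\<open>converge_D\<close> is what makes infinitely many simultaneous block maps
  continuous at \<open>p\<close>. \<open>e_0\<close> identifies \<open>D 0\<close> with the model
  block, so that a homeomorphism supported in \<open>D 0\<close> is itself a pasted map.\<close>

locale swindle_blocks =
  fixes K :: "'a::metric_space set" and D :: "int \<Rightarrow> 'a set" and e e' :: "int \<Rightarrow> 'a \<Rightarrow> 'a" and p :: 'a
  assumes clopen_D: "\<And>i. clopenin K (D i)"
    and disjoint_D: "\<And>i j. i \<noteq> j \<Longrightarrow> D i \<inter> D j = {}"
    and p: "p \<in> K" "\<And>i. p \<notin> D i"
    and converge_D: "\<And>N. open N \<Longrightarrow> p \<in> N \<Longrightarrow> finite {i. \<not> D i \<subseteq> N}"
    and homeo_e: "\<And>i. homeomorphism (D 0) (D i) (e i) (e' i)"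
    and e_0: "\<And>x. x \<in> D 0 \<Longrightarrow> e 0 x = x"
begin

text \<open>Sends the block \<open>D i\<close> to \<open>D (\<tau> i)\<close>, acting by \<open>u i\<close> in the coordinate of \<open>D 0\<close>.\<close>

definition paste :: "(int \<Rightarrow> int) \<Rightarrow> (int \<Rightarrow> 'a \<Rightarrow> 'a) \<Rightarrow> 'a \<Rightarrow> 'a" where
  "paste \<tau> u x = (if \<exists>i. x \<in> D i then let i = (THE i. x \<in> D i) in e (\<tau> i) (u i (e' i x)) else x)"

lemma paste_in: "x \<in> D i \<Longrightarrow> paste \<tau> u x = e (\<tau> i) (u i (e' i x))"
proof -
  assume x: "x \<in> D i"
  then have "(THE i. x \<in> D i) = i" using disjoint_D by (intro the_equality) blast+
  then show ?thesis using x by (auto simp: paste_def Let_def)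
qed

lemma paste_out: "(\<And>i. x \<notin> D i) \<Longrightarrow> paste \<tau> u x = x"
  by (simp add: paste_def)

lemma e_in: "x \<in> D 0 \<Longrightarrow> e i x \<in> D i" and e'_in: "y \<in> D i \<Longrightarrow> e' i y \<in> D 0"
  and e'_e: "x \<in> D 0 \<Longrightarrow> e' i (e i x) = x" and e_e': "y \<in> D i \<Longrightarrow> e i (e' i y) = y"
  using homeo_e[of i] unfolding homeomorphism_def by auto

lemma paste_mem: "x \<in> D i \<Longrightarrow> u i ` D 0 \<subseteq> D 0 \<Longrightarrow> paste \<tau> u x \<in> D (\<tau> i)"
  using e'_in[of x i] by (auto simp: paste_in intro!: e_in)

lemma paste_cong:
  assumes "\<And>i y. y \<in> D 0 \<Longrightarrow> u i y = u' i y"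
  shows "paste \<tau> u x = paste \<tau> u' x"
proof (cases "\<exists>i. x \<in> D i")
  case True
  then obtain i where i: "x \<in> D i" ..
  show ?thesis by (simp add: paste_in[OF i] assms[OF e'_in[OF i]])
qed (simp add: paste_out)

lemma paste_paste:
  assumes "\<And>i. u i ` D 0 \<subseteq> D 0"
  shows "paste \<tau>' u' (paste \<tau> u x) = paste (\<lambda>i. \<tau>' (\<tau> i)) (\<lambda>i y. u' (\<tau> i) (u i y)) x"
proof (cases "\<exists>i. x \<in> D i")
  case True
  then obtain i where i: "x \<in> D i" ..
  have u: "u i (e' i x) \<in> D 0" using assms e'_in[OF i] by blast
  show ?thesis by (simp add: paste_in[OF i] paste_in[OF e_in[OF u]] e'_e[OF u])
qed (simp add: paste_out)

lemma paste_id: "paste (\<lambda>i. i) (\<lambda>i y. y) x = x"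
proof (cases "\<exists>i. x \<in> D i")
  case True
  then obtain i where i: "x \<in> D i" ..
  show ?thesis by (simp add: paste_in[OF i] e_e'[OF i])
qed (simp add: paste_out)

lemma paste_K:
  assumes "\<And>i. u i ` D 0 \<subseteq> D 0" "x \<in> K"
  shows "paste \<tau> u x \<in> K"
proof (cases "\<exists>i. x \<in> D i")
  case True
  then obtain i where i: "x \<in> D i" ..
  show ?thesis by (rule subsetD[OF clopenin_subset[OF clopen_D] paste_mem[where u = u, OF i assms(1)]])
qed (simp add: paste_out assms)

text \<open>Three kinds of points. A block is clopen, so inside it the block formula decides. Any
  other point except \<open>p\<close> has a neighbourhood that meets finitely many blocks, which can
  be removed. At \<open>p\<close>, injectivity of \<tau> ensures that only finitely many blocks are
  sent outside a given neighbourhood; these are removed too.\<close>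

lemma continuous_on_paste:
  assumes inj: "inj \<tau>" and u: "\<And>i. u i ` D 0 \<subseteq> D 0" and cont: "\<And>i. continuous_on (D 0) (u i)"
  shows "continuous_on K (paste \<tau> u)"
  unfolding continuous_openin_preimage_eq
proof (intro allI impI, subst openin_subopen, intro ballI)
  fix T x assume T: "open T" and x: "x \<in> K \<inter> paste \<tau> u -` T"
  have closed_Un: "closedin (top_of_set K) (\<Union>i\<in>J. D i)" if "finite J" for J
    using clopen_D that by (auto simp: clopenin_def intro!: closedin_Union)
  have open_minus: "openin (top_of_set K) (K \<inter> V - (\<Union>i\<in>J. D i))" if "open V" "finite J" for V J
    using closed_Un[OF that(2)] that(1) by (intro openin_diff openin_open_Int) auto
  show "\<exists>V. openin (top_of_set K) V \<and> x \<in> V \<and> V \<subseteq> K \<inter> paste \<tau> u -` T"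
  proof (cases "\<exists>i. x \<in> D i")
    case True
    then obtain i where i: "x \<in> D i" ..
    have "e' i ` D i \<subseteq> D 0" using e'_in by blast
    with cont homeomorphism_cont2[OF homeo_e] have "continuous_on (D i) (\<lambda>y. u i (e' i y))"
      by (rule continuous_on_compose2)
    moreover have "(\<lambda>y. u i (e' i y)) ` D i \<subseteq> D 0" using e'_in u by blast
    ultimately have "continuous_on (D i) (\<lambda>y. e (\<tau> i) (u i (e' i y)))"
      by (rule continuous_on_compose2[OF homeomorphism_cont1[OF homeo_e]])
    then have "continuous_on (D i) (paste \<tau> u)"
      by (rule continuous_on_eq) (simp only: paste_in)
    then have "openin (top_of_set (D i)) (D i \<inter> paste \<tau> u -` T)"
      using T by (simp add: continuous_openin_preimage_eq)
    then have "openin (top_of_set K) (D i \<inter> paste \<tau> u -` T)"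
      using clopen_D openin_trans unfolding clopenin_def by blast
    then show ?thesis using i x clopenin_subset[OF clopen_D] by blast
  next
    case False
    then have fx: "x \<in> T" using x by (simp add: paste_out)
    show ?thesis
    proof (cases "x = p")
      case True
      have "{i. \<not> D (\<tau> i) \<subseteq> T} = \<tau> -` {i. \<not> D i \<subseteq> T}" by auto
      then have fin: "finite {i. \<not> D (\<tau> i) \<subseteq> T}"
        using finite_vimageI[OF converge_D[OF T] inj] fx True by simp
      let ?V = "K \<inter> T - (\<Union>i\<in>{i. \<not> D (\<tau> i) \<subseteq> T}. D i)"
      have "paste \<tau> u y \<in> T" if y: "y \<in> ?V" for y
      proof (cases "\<exists>i. y \<in> D i")
        case True
        then obtain i where i: "y \<in> D i" ..
        then have "D (\<tau> i) \<subseteq> T" using y by auto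
        then show ?thesis using paste_mem[where u = u and \<tau> = \<tau>, OF i u] by blast
      qed (use y in \<open>simp add: paste_out\<close>)
      moreover have "x \<in> ?V" using True p fx by auto
      moreover have "?V \<subseteq> K" by blast
      ultimately have "x \<in> ?V \<and> ?V \<subseteq> K \<inter> paste \<tau> u -` T" by blast
      with open_minus[OF T fin] show ?thesis by blast
    next
      case ne: False
      then obtain N M where NM: "open N" "open M" "p \<in> N" "x \<in> M" "N \<inter> M = {}"
        using hausdorff[of p x] by metis
      have fin: "finite {i. \<not> D i \<subseteq> N}" by (rule converge_D[OF NM(1,3)])
      let ?V = "K \<inter> (M \<inter> T) - (\<Union>i\<in>{i. \<not> D i \<subseteq> N}. D i)"
      have "y \<notin> D i" if y: "y \<in> ?V" for y i
        using that NM(5) by auto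
      then have "paste \<tau> u y \<in> T" if y: "y \<in> ?V" for y
        using that by (simp add: paste_out)
      moreover have "x \<in> ?V" using False fx NM x by auto
      moreover have "openin (top_of_set K) ?V" using NM T by (intro open_minus fin open_Int)
      ultimately have "openin (top_of_set K) ?V \<and> x \<in> ?V \<and> ?V \<subseteq> K \<inter> paste \<tau> u -` T" by blast
      then show ?thesis by (rule exI)
    qed
  qed
qed

text \<open>On \<open>D i\<close> the inverse has to undo the map of the block
  \<open>\<tau>' i\<close> that was moved there, whence the index of \<open>u'\<close>.\<close>

lemma homeomorphism_paste:
  assumes \<tau>: "\<And>i. \<tau>' (\<tau> i) = i" "\<And>i. \<tau> (\<tau>' i) = i" and u: "\<And>i. homeomorphism (D 0) (D 0) (u i) (u' i)"
  shows "homeomorphism K K (paste \<tau> u) (paste \<tau>' (\<lambda>i. u' (\<tau>' i)))"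
proof -
  have u1: "\<And>i. u i ` D 0 \<subseteq> D 0" "\<And>i. u' i ` D 0 \<subseteq> D 0"
    "\<And>i. continuous_on (D 0) (u i)" "\<And>i. continuous_on (D 0) (u' i)"
    using u unfolding homeomorphism_def by auto
  have u2: "\<And>i y. y \<in> D 0 \<Longrightarrow> u' i (u i y) = y" "\<And>i y. y \<in> D 0 \<Longrightarrow> u i (u' i y) = y"
    using u unfolding homeomorphism_def by auto
  show ?thesis
  proof (rule homeomorphismI)
    show "continuous_on K (paste \<tau> u)" "continuous_on K (paste \<tau>' (\<lambda>i. u' (\<tau>' i)))"
      using \<tau> by (auto intro!: continuous_on_paste u1 injI) metis+
    show "paste \<tau> u ` K \<subseteq> K" "paste \<tau>' (\<lambda>i. u' (\<tau>' i)) ` K \<subseteq> K"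
      using paste_K u1 by auto
    fix x
    have "paste (\<lambda>i. i) (\<lambda>i y. u' i (u i y)) x = x" for x
      using paste_cong[of "\<lambda>i y. u' i (u i y)" "\<lambda>i y. y"] u2 paste_id by simp
    then show "paste \<tau>' (\<lambda>i. u' (\<tau>' i)) (paste \<tau> u x) = x"
      by (subst paste_paste) (use u1 \<tau> in auto)
    have "paste (\<lambda>i. i) (\<lambda>i y. u (\<tau>' i) (u' (\<tau>' i) y)) x = x" for x
      using paste_cong[of "\<lambda>i y. u (\<tau>' i) (u' (\<tau>' i) y)" "\<lambda>i y. y"] u2 paste_id by simp
    then show "paste \<tau> u (paste \<tau>' (\<lambda>i. u' (\<tau>' i)) x) = x"
      by (subst paste_paste) (use u1 \<tau> in auto)
  qed
qed

end

section \<open>Construction of the blocks\<close>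

text \<open>Some point other than \<open>p\<close> is expelled at every step, so the differences of
  consecutive sets are nonempty and can serve as blocks.\<close>

lemma shrinking_clopen_nbhds:
  fixes K :: "'a::metric_space set"
  assumes K: "cantor_set K" and A: "clopenin K A" and p: "p \<in> A"
  obtains B :: "nat \<Rightarrow> 'a set" where "B 0 = A" "\<And>n. clopenin K (B n)" "\<And>n. p \<in> B n" "\<And>n. B (Suc n) \<subset> B n"
    "\<And>n. B (Suc n) \<subseteq> ball p (inverse (real (Suc n)))"
proof -
  have "\<exists>B'. (clopenin K B' \<and> p \<in> B') \<and> (B' \<subset> B \<and> B' \<subseteq> ball p (inverse (real (Suc n))))"
    if B: "clopenin K B \<and> p \<in> B" for B n
  proof -
    have "infinite (B - {p})"
      using cantor_set_open_infinite[OF K, of B] B by (auto simp: clopenin_def)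
    then obtain y where y: "y \<in> B" "y \<noteq> p" using infinite_imp_nonempty by blast
    have "openin (top_of_set K) (B \<inter> (ball p (inverse (real (Suc n))) - {y}))"
      using B by (intro openin_Int_open) (auto simp: clopenin_def)
    moreover have "{p} \<subseteq> B \<inter> (ball p (inverse (real (Suc n))) - {y})" using B y by (simp del: of_nat_Suc)
    ultimately obtain B' where "clopenin K B'" "{p} \<subseteq> B'" "B' \<subseteq> B \<inter> (ball p (inverse (real (Suc n))) - {y})"
      by (rule clopen_nbhd[OF K]) auto
    then show ?thesis using y by (intro exI[of _ B']) auto
  qed
  note step = this
  have "\<exists>B. \<forall>n. ((clopenin K (B n) \<and> p \<in> B n) \<and> (n = 0 \<longrightarrow> B n = A)) \<and> (B (Suc n) \<subset> B n \<and> B (Suc n) \<subseteq> ball p (inverse (real (Suc n))))"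
  proof (rule dependent_nat_choice)
    show "\<exists>B. (clopenin K B \<and> p \<in> B) \<and> (0 = (0::nat) \<longrightarrow> B = A)" using A p by auto
    fix B n assume "(clopenin K B \<and> p \<in> B) \<and> (n = (0::nat) \<longrightarrow> B = A)"
    then have "clopenin K B \<and> p \<in> B" by (rule conjunct1)
    from step[OF this, of n] show "\<exists>B'. ((clopenin K B' \<and> p \<in> B') \<and> (Suc n = 0 \<longrightarrow> B' = A)) \<and> (B' \<subset> B \<and> B' \<subseteq> ball p (inverse (real (Suc n))))"
      by (elim exE) (intro exI conjI, auto)
  qed
  then obtain B where B: "\<forall>n. ((clopenin K (B n) \<and> p \<in> B n) \<and> (n = 0 \<longrightarrow> B n = A)) \<and> (B (Suc n) \<subset> B n \<and> B (Suc n) \<subseteq> ball p (inverse (real (Suc n))))"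
    by (rule exE)
  show ?thesis
    by (rule that[of B]) (simp_all only: B simp_thms)
qed

text \<open>The block \<open>D 0\<close> is everything outside \<open>W\<close> and a small clopen
  neighbourhood \<open>B0\<close> of \<open>p\<close>; the other blocks are the rings of a shrinking
  sequence in \<open>B0\<close>. All are nonempty clopen sets, hence Cantor sets homeomorphic to
  \<open>D 0\<close>.\<close>

lemma swindle_blocks_exist:
  fixes K :: "'a::metric_space set"
  assumes K: "cantor_set K" and U: "openin (top_of_set K) U" and P: "P \<subseteq> U" "finite P" "P \<noteq> {}"
  shows "\<exists>D e e' p W. swindle_blocks K D e e' p \<and> K - U \<subseteq> D 0 \<and> openin (top_of_set K) W \<and> P \<subseteq> W \<and> (\<forall>i. W \<inter> D i = {})"
proof -
  have UK: "U \<subseteq> K" using U by (rule openin_imp_subset)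
  have "infinite U" using cantor_set_open_infinite[OF K U] P by auto
  then have "infinite (U - P)" using P by simp
  then obtain p where p: "p \<in> U - P" using infinite_imp_nonempty by blast
  have "infinite (U - P - {p})" using \<open>infinite (U - P)\<close> by simp
  \<comment> \<open>Kept out of \<open>W\<close> and \<open>B0\<close> so that \<open>D 0\<close> is
    nonempty even if \<open>U\<close> is all of \<open>K\<close>.\<close>
  then obtain q where q: "q \<in> U - P - {p}" using infinite_imp_nonempty by blast
  have "openin (top_of_set K) (U \<inter> - {p, q})" using U by (rule openin_Int_open) auto
  moreover have "P \<subseteq> U \<inter> - {p, q}" using P p q by auto
  ultimately obtain W where W: "clopenin K W" "P \<subseteq> W" "W \<subseteq> U \<inter> - {p, q}"
    by (rule clopen_nbhd[OF K _ _ P(2)])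
  have "openin (top_of_set K) ((U - W) \<inter> - {q})"
    using U W by (intro openin_Int_open openin_diff) (auto simp: clopenin_def)
  moreover have "{p} \<subseteq> (U - W) \<inter> - {q}" using p q W by auto
  ultimately obtain B0 where B0: "clopenin K B0" "{p} \<subseteq> B0" "B0 \<subseteq> (U - W) \<inter> - {q}"
    by (rule clopen_nbhd[OF K]) auto
  have "p \<in> B0" using B0 by simp
  then obtain B :: "nat \<Rightarrow> 'a set" where B: "B 0 = B0" "\<And>n. clopenin K (B n)" "\<And>n. p \<in> B n" "\<And>n. B (Suc n) \<subset> B n"
    "\<And>n. B (Suc n) \<subseteq> ball p (inverse (real (Suc n)))"
    by (rule shrinking_clopen_nbhds[OF K B0(1)]) (rule that)
  have B_mono: "B n \<subseteq> B m" if "m \<le> n" for m n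
    using that by (induction rule: dec_induct) (use B(4) in blast)+
  define E where "E n = (case n of 0 \<Rightarrow> K - (W \<union> B0) | Suc m \<Rightarrow> B m - B (Suc m))" for n
  have clE: "clopenin K (E n)" for n
    using B W B0 by (auto simp: E_def split: nat.split intro!: clopenin_Diff clopenin_Un)
  have neE: "E n \<noteq> {}" for n
  proof (cases n)
    case 0
    have "q \<in> K - (W \<union> B0)" using q W(3) B0(3) UK by blast
    then show ?thesis by (auto simp: E_def 0)
  next
    case (Suc m)
    then show ?thesis using B(4)[of m] by (auto simp: E_def)
  qed
  have E_B: "E (Suc n) \<subseteq> B n" for n by (auto simp: E_def)
  have disjE: "E m \<inter> E n = {}" if mn: "m < n" for m n
  proof -
    obtain n' where n: "n = Suc n'" using mn by (cases n) auto
    show ?thesis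
    proof (cases m)
      case 0
      then show ?thesis using B_mono[of 0 n'] B(1) by (auto simp: E_def n)
    next
      case (Suc m')
      then have "B n' \<subseteq> B (Suc m')" using mn n by (intro B_mono) simp
      then show ?thesis by (auto simp: E_def n Suc)
    qed
  qed
  have W_E: "W \<inter> E n = {}" for n
  proof (cases n)
    case (Suc m)
    then show ?thesis using E_B[of m] B_mono[of 0 m] B(1) B0(3) by auto
  qed (auto simp: E_def)
  have p_E: "p \<notin> E n" for n
    using B(3) B0 by (auto simp: E_def split: nat.split)
  \<comment> \<open>Reindexing by the integers; \<open>int_encode\<close> sends 0 to 0, so the large
    piece \<open>E 0\<close> becomes \<open>D 0\<close>.\<close>
  define D where "D i = E (int_encode i)" for i
  have D0: "D 0 = K - (W \<union> B0)" by (simp add: D_def E_def int_encode_def sum_encode_def)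
  have "cantor_set (D i)" "D i \<noteq> {}" for i
    using cantor_set_clopenin[OF K clE] neE by (auto simp: D_def)
  then have "D 0 homeomorphic D i" for i by (intro cantor_sets_homeomorphic)
  then have "\<forall>i. \<exists>e. homeomorphism (D 0) (D i) (fst e) (snd e)" by (auto simp: homeomorphic_def)
  then obtain e0 where e0: "\<forall>i. homeomorphism (D 0) (D i) (fst (e0 i)) (snd (e0 i))" by (rule choice[THEN exE])
  \<comment> \<open>The chosen self-homeomorphism of \<open>D 0\<close> need not be the identity, so
    it is replaced.\<close>
  define e where "e i = (if i = 0 then id else fst (e0 i))" for i :: int
  define e' where "e' i = (if i = 0 then id else snd (e0 i))" for i :: int
  have "swindle_blocks K D e e' p"
  proof
    show "clopenin K (D i)" for i using clE by (simp add: D_def)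
    show "D i \<inter> D j = {}" if "i \<noteq> j" for i j
    proof -
      have "int_encode i \<noteq> int_encode j" using that by (simp add: int_encode_eq)
      then have "int_encode i < int_encode j \<or> int_encode j < int_encode i" by linarith
      then show ?thesis
        using disjE[of "int_encode i" "int_encode j"] disjE[of "int_encode j" "int_encode i"]
        by (auto simp: D_def)
    qed
    show "p \<in> K" using p UK by auto
    show "p \<notin> D i" for i using p_E by (simp add: D_def)
    show "finite {i. \<not> D i \<subseteq> N}" if N: "open N" "p \<in> N" for N
    proof -
      obtain r where r: "r > 0" "ball p r \<subseteq> N" by (rule openE[OF N])
      obtain n where n: "inverse (real (Suc n)) < r" using reals_Archimedean[OF r(1)] by blast
      have EN: "E m \<subseteq> N" if mn: "m > Suc n" for m
      proof -
        obtain m' where m: "m = Suc m'" using mn by (cases m) auto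
        have "E m \<subseteq> B (Suc n)" using E_B[of m'] B_mono[of "Suc n" m'] mn m by auto
        also have "\<dots> \<subseteq> ball p r" using B(5)[of n] n by auto
        finally show ?thesis using r by blast
      qed
      have "int_encode i \<le> Suc n" if "\<not> D i \<subseteq> N" for i
        using EN[of "int_encode i"] that by (auto simp: D_def not_less[symmetric])
      then have "{i. \<not> D i \<subseteq> N} \<subseteq> int_encode -` {..Suc n}" by auto
      moreover have "finite (int_encode -` {..Suc n})"
        by (intro finite_vimageI inj_int_encode) simp
      ultimately show ?thesis by (rule finite_subset)
    qed
    show "homeomorphism (D 0) (D i) (e i) (e' i)" for i
      using e0 by (cases "i = 0") (auto simp: e_def e'_def homeomorphism_ident id_def)
    show "e 0 x = x" for x by (simp add: e_def)
  qed
  moreover have "K - U \<subseteq> D 0" using W B0 by (auto simp: D0)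
  moreover have "\<forall>i. W \<inter> D i = {}" using W_E by (simp add: D_def)
  ultimately show ?thesis using W by (auto simp: clopenin_def)
qed

section \<open>The germ stabilizer as a group\<close>

lemma homeo_groupD:
  assumes "f \<in> carrier (homeo_group K)"
  shows "f \<in> extensional K" "\<exists>g. homeomorphism K K f g" "bij_betw f K K" "f \<in> Bij K" "f ` K = K" "inj_on f K"
proof -
  show 1: "f \<in> extensional K" "\<exists>g. homeomorphism K K f g"
    using assms by (auto simp: homeo_group_def)
  then obtain g where g: "homeomorphism K K f g" by blast
  show "f ` K = K" by (rule homeomorphism_image1[OF g])
  moreover show "inj_on f K" using homeomorphism_apply1[OF g] by (rule inj_on_inverseI)
  ultimately show "bij_betw f K K" by (simp add: bij_betw_def)
  then show "f \<in> Bij K" using 1 by (simp add: Bij_def)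
qed

lemma homeo_group_memI: "homeomorphism K K f g \<Longrightarrow> restrict f K \<in> carrier (homeo_group K)"
  unfolding homeo_group_def by (auto intro!: exI[of _ g] elim!: homeomorphism_cong)

text \<open>Inverses enter only through a pointwise identity, which hides the extensional
  \<open>inv_into\<close> of \<open>BijGroup\<close>. It serves the full homeomorphism group, the
  germ stabilizer and a pointwise fixer below.\<close>

lemma subgroup_homeosI:
  fixes K :: "'a::topological_space set"
  assumes sub: "T \<subseteq> carrier (homeo_group K)" and one: "(\<lambda>x\<in>K. x) \<in> T"
    and comp: "\<And>f g. f \<in> T \<Longrightarrow> g \<in> T \<Longrightarrow> compose K f g \<in> T"
    and inv: "\<And>f f'. f \<in> T \<Longrightarrow> f' \<in> carrier (homeo_group K) \<Longrightarrow> (\<And>y. y \<in> K \<Longrightarrow> f' (f y) = y) \<Longrightarrow> f' \<in> T"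
  shows "subgroup T (BijGroup K)"
proof -
  interpret B: group "BijGroup K" by (rule group_BijGroup)
  have TB: "f \<in> Bij K" if "f \<in> T" for f using homeo_groupD(4) sub that by blast
  show ?thesis
  proof (rule B.subgroupI)
    show "T \<subseteq> carrier (BijGroup K)" using TB by (auto simp: BijGroup_def)
    show "T \<noteq> {}" using one by auto
    show "f \<otimes>\<^bsub>BijGroup K\<^esub> g \<in> T" if "f \<in> T" "g \<in> T" for f g
      using comp[OF that] TB that by (simp add: BijGroup_def)
    fix f assume f: "f \<in> T"
    then obtain g where g: "homeomorphism K K f g" using homeo_groupD(2) sub by blast
    let ?f' = "restrict (inv_into K f) K"
    have f': "inv_into K f y = g y" if "y \<in> K" for y
      using g that homeo_groupD(6) f sub by (metis homeomorphism_def image_eqI inv_into_f_f subsetD)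
    have "homeomorphism K K g f" using g by (rule homeomorphism_symD)
    then have "restrict g K \<in> carrier (homeo_group K)" by (rule homeo_group_memI)
    moreover have "restrict g K = ?f'" using f' by auto
    ultimately have "?f' \<in> carrier (homeo_group K)" by simp
    then have "?f' \<in> T"
      using homeo_groupD(5,6)[of f K] f sub by (intro inv[OF f]) auto
    then show "inv\<^bsub>BijGroup K\<^esub> f \<in> T" using inv_BijGroup[OF TB[OF f]] by simp
  qed
qed

lemma homeo_group_eq: "homeo_group K = (BijGroup K)\<lparr>carrier := carrier (homeo_group K)\<rparr>"
  by (simp add: homeo_group_def)

lemma homeo_group_one: "(\<lambda>x\<in>K. x) \<in> carrier (homeo_group K)"
  by (rule homeo_group_memI[where g = "\<lambda>x. x"]) (rule homeomorphism_ident)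

lemma homeo_group_compose:
  assumes "f \<in> carrier (homeo_group K)" "g \<in> carrier (homeo_group K)"
  shows "compose K f g \<in> carrier (homeo_group K)"
proof -
  obtain f' g' where "homeomorphism K K f f'" "homeomorphism K K g g'"
    using homeo_groupD(2) assms by metis
  then have "homeomorphism K K (f \<circ> g) (g' \<circ> f')" by (rule homeomorphism_compose[rotated])
  then have "restrict (f \<circ> g) K \<in> carrier (homeo_group K)" by (rule homeo_group_memI)
  then show ?thesis by (simp add: compose_def comp_def)
qed

lemma subgroup_homeo_group: "subgroup (carrier (homeo_group K)) (BijGroup K)"
  by (rule subgroup_homeosI) (auto intro: homeo_group_one homeo_group_compose)

lemma subgroup_germ_stabilizer_Bij:
  fixes K :: "'a::topological_space set"
  assumes x: "\<And>i. i \<in> {1..k} \<Longrightarrow> x i \<in> K"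
  shows "subgroup (germ_stabilizer K k x) (BijGroup K)"
proof (rule subgroup_homeosI)
  show "germ_stabilizer K k x \<subseteq> carrier (homeo_group K)" by (auto simp: germ_stabilizer_def)
  show "(\<lambda>x\<in>K. x) \<in> germ_stabilizer K k x"
    using x homeo_group_one by (auto simp: germ_stabilizer_def intro!: exI[of _ K])
next
  fix f g assume f: "f \<in> germ_stabilizer K k x" and g: "g \<in> germ_stabilizer K k x"
  show "compose K f g \<in> germ_stabilizer K k x"
    unfolding germ_stabilizer_def
  proof (intro CollectI conjI ballI)
    show "compose K f g \<in> carrier (homeo_group K)"
      using f g by (intro homeo_group_compose) (auto simp: germ_stabilizer_def)
    fix i assume i: "i \<in> {1..k}"
    obtain U where U: "openin (top_of_set K) U" "x i \<in> U" "\<forall>y\<in>U. f y = y"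
      using f i unfolding germ_stabilizer_def by blast
    obtain V where V: "openin (top_of_set K) V" "x i \<in> V" "\<forall>y\<in>V. g y = y"
      using g i unfolding germ_stabilizer_def by blast
    have "U \<subseteq> K" using U(1) by (rule openin_imp_subset)
    then show "\<exists>W. openin (top_of_set K) W \<and> x i \<in> W \<and> (\<forall>y\<in>W. compose K f g y = y)"
      using U V by (intro exI[of _ "U \<inter> V"]) (auto simp: compose_def)
  qed
next
  fix f f' assume f: "f \<in> germ_stabilizer K k x" and f': "f' \<in> carrier (homeo_group K)"
    and inv: "\<And>y. y \<in> K \<Longrightarrow> f' (f y) = y"
  show "f' \<in> germ_stabilizer K k x"
    unfolding germ_stabilizer_def
  proof (intro CollectI conjI ballI f')
    fix i assume i: "i \<in> {1..k}"
    obtain U where U: "openin (top_of_set K) U" "x i \<in> U" "\<forall>y\<in>U. f y = y"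
      using f i unfolding germ_stabilizer_def by blast
    have "U \<subseteq> K" using U(1) by (rule openin_imp_subset)
    then have "\<forall>y\<in>U. f' y = y" using inv U(3) by (metis subsetD)
    then show "\<exists>W. openin (top_of_set K) W \<and> x i \<in> W \<and> (\<forall>y\<in>W. f' y = y)"
      using U by blast
  qed
qed

lemma subgroup_germ_stabilizer:
  fixes K :: "'a::topological_space set"
  assumes x: "\<And>i. i \<in> {1..k} \<Longrightarrow> x i \<in> K"
  shows "subgroup (germ_stabilizer K k x) (homeo_group K)"
proof -
  have "subgroup (germ_stabilizer K k x) ((BijGroup K)\<lparr>carrier := carrier (homeo_group K)\<rparr>)"
    by (rule group.subgroup_incl[OF group_BijGroup subgroup_germ_stabilizer_Bij subgroup_homeo_group])
       (auto simp: x germ_stabilizer_def)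
  then show ?thesis by (simp flip: homeo_group_eq)
qed

lemma germ_stabilizer_group_eq:
  "(homeo_group K)\<lparr>carrier := germ_stabilizer K k x\<rparr> = (BijGroup K)\<lparr>carrier := germ_stabilizer K k x\<rparr>"
  by (simp add: homeo_group_def)

section \<open>The swindle\<close>

lemma (in swindle_blocks) germ_memI:
  assumes \<tau>: "\<And>i. \<tau>' (\<tau> i) = i" "\<And>i. \<tau> (\<tau>' i) = i" and u: "\<And>i. \<exists>u'. homeomorphism (D 0) (D 0) (u i) u'"
    and W: "openin (top_of_set K) W" "\<And>i. i \<in> {1..k} \<Longrightarrow> x i \<in> W" "\<And>i. W \<inter> D i = {}"
  shows "restrict (paste \<tau> u) K \<in> germ_stabilizer K k x"
proof -
  from u have "\<forall>i. \<exists>u'. homeomorphism (D 0) (D 0) (u i) u'" by blast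
  then obtain u' where "\<forall>i. homeomorphism (D 0) (D 0) (u i) (u' i)" by (rule choice[THEN exE])
  then have "homeomorphism K K (paste \<tau> u) (paste \<tau>' (\<lambda>i. u' (\<tau>' i)))"
    by (intro homeomorphism_paste \<tau>) blast
  then have "restrict (paste \<tau> u) K \<in> carrier (homeo_group K)" by (rule homeo_group_memI)
  moreover have "restrict (paste \<tau> u) K y = y" if "y \<in> W" for y
  proof -
    have "y \<in> K" using W(1) that openin_imp_subset by blast
    moreover have "y \<notin> D i" for i using W(3)[of i] that by blast
    ultimately show ?thesis by (simp add: paste_out)
  qed
  ultimately show ?thesis using W(1,2) unfolding germ_stabilizer_def by blast
qed

text \<open>Here \<open>\<phi> h\<close> performs \<open>h\<close> in every block \<open>D i\<close> with \<open>i \<ge> 0\<close>, and \<open>\<gamma>\<close> moves \<open>D i\<close> to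
  \<open>D (i - 1)\<close>. Thus \<open>\<gamma>\<^sup>-\<^sup>1 \<phi>(h) \<gamma>\<close> performs \<open>h\<close> only in the blocks with \<open>i \<ge> 1\<close>.\<close>

lemma binate_germ_stabilizer:
  fixes K :: "'a::metric_space set"
  assumes K: "cantor_set K" and k: "k \<ge> 1" and x: "\<And>i. i \<in> {1..k} \<Longrightarrow> x i \<in> K"
  shows "binate ((homeo_group K)\<lparr>carrier := germ_stabilizer K k x\<rparr>)"
proof -
  define G where "G = (BijGroup K)\<lparr>carrier := germ_stabilizer K k x\<rparr>"
  have "group G" unfolding G_def
    by (rule subgroup.subgroup_is_group[OF subgroup_germ_stabilizer_Bij group_BijGroup]) (rule x)
  then interpret G: group G .
  have carrier_G: "carrier G = germ_stabilizer K k x" by (simp add: G_def)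
  have G_homeo: "f \<in> carrier (homeo_group K)" if "f \<in> carrier G" for f
    using that by (simp add: carrier_G germ_stabilizer_def)
  have mult: "f \<otimes>\<^bsub>G\<^esub> g = compose K f g" if "f \<in> carrier G" "g \<in> carrier G" for f g
    using homeo_groupD(4)[OF G_homeo] that by (simp add: G_def BijGroup_def)
  have "binate G"
    unfolding binate_def
  proof (intro conjI allI impI)
    show "group G" by fact
    fix H assume "finitely_generated_subgroup H G"
    then obtain S where H: "subgroup H G" and S: "finite S" "S \<subseteq> carrier G" "H = generate G S"
      by (auto simp: finitely_generated_subgroup_def)
    let ?P = "x ` {1..k}"
    have "\<exists>V. openin (top_of_set K) V \<and> ?P \<subseteq> V \<and> (\<forall>y\<in>V. g y = y)" if "g \<in> S" for g
    proof -
      have "\<forall>i\<in>{1..k}. \<exists>U. openin (top_of_set K) U \<and> x i \<in> U \<and> (\<forall>y\<in>U. g y = y)"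
        using that S(2) unfolding carrier_G germ_stabilizer_def by blast
      then obtain U where U: "\<forall>i\<in>{1..k}. openin (top_of_set K) (U i) \<and> x i \<in> U i \<and> (\<forall>y\<in>U i. g y = y)"
        by (rule bchoice[THEN exE])
      then have "openin (top_of_set K) (\<Union>i\<in>{1..k}. U i)" by (intro openin_Union) auto
      then show ?thesis using U by (intro exI[of _ "\<Union>i\<in>{1..k}. U i"]) auto
    qed
    then have "\<forall>g\<in>S. \<exists>V. openin (top_of_set K) V \<and> ?P \<subseteq> V \<and> (\<forall>y\<in>V. g y = y)" by blast
    then obtain V where V: "\<forall>g\<in>S. openin (top_of_set K) (V g) \<and> ?P \<subseteq> V g \<and> (\<forall>y\<in>V g. g y = y)"
      by (rule bchoice[THEN exE])
    \<comment> \<open>Finite generation is used here: a finite intersection of neighbourhoods is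
      open. The intersection with \<open>K\<close> covers the case without generators.\<close>
    define U where "U = (\<Inter>g\<in>S. V g) \<inter> K"
    have UK: "U \<subseteq> K" by (simp add: U_def)
    have "openin (top_of_set K) U"
    proof (cases "S = {}")
      case False
      then have "openin (top_of_set K) (\<Inter>g\<in>S. V g)" using S(1) V by (intro openin_INT2) auto
      then show ?thesis by (simp add: U_def openin_Int)
    qed (simp add: U_def)
    moreover have "?P \<subseteq> U" using V x unfolding U_def by blast
    moreover have "finite ?P" "?P \<noteq> {}" using k by auto
    ultimately obtain D e e' p W where sw: "swindle_blocks K D e e' p" and D0: "K - U \<subseteq> D 0"
      and W: "openin (top_of_set K) W" "?P \<subseteq> W" "\<forall>i. W \<inter> D i = {}"
      using swindle_blocks_exist[OF K, of U ?P] by blast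
    interpret swindle_blocks K D e e' p by (rule sw)
    have HG: "H \<subseteq> carrier G" by (rule subgroup.subset[OF H])
    \<comment> \<open>The elements of \<open>G\<close> that fix \<open>U\<close> pointwise form a
      subgroup, and it contains the generators.\<close>
    have fixU: "h y = y" if h: "h \<in> H" and y: "y \<in> U" for h y
    proof -
      let ?T = "{f \<in> carrier G. \<forall>y\<in>U. f y = y}"
      have "subgroup ?T (BijGroup K)"
      proof (rule subgroup_homeosI)
        show "?T \<subseteq> carrier (homeo_group K)" using G_homeo by blast
        show "(\<lambda>x\<in>K. x) \<in> ?T"
          using G.one_closed UK by (auto simp: G_def BijGroup_def)
        show "compose K f g \<in> ?T" if "f \<in> ?T" "g \<in> ?T" for f g
          using that G.m_closed[of f g] UK by (auto simp: mult compose_def)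
        fix f f' assume f: "f \<in> ?T" and f': "f' \<in> carrier (homeo_group K)"
          and inv: "\<And>y. y \<in> K \<Longrightarrow> f' (f y) = y"
        have "f' = inv\<^bsub>G\<^esub> f"
        proof -
          have f'B: "f' \<in> Bij K" by (rule homeo_groupD(4)[OF f'])
          have fB: "f \<in> Bij K" using f G_homeo homeo_groupD(4) by blast
          have "f' \<otimes>\<^bsub>BijGroup K\<^esub> f = \<one>\<^bsub>BijGroup K\<^esub>"
            using inv f'B fB by (auto simp: BijGroup_def compose_def)
          then have "f' = inv\<^bsub>BijGroup K\<^esub> f"
            using f'B fB group.inv_equality[OF group_BijGroup, of K f' f] by (simp add: BijGroup_def)
          moreover have "inv\<^bsub>G\<^esub> f = inv\<^bsub>BijGroup K\<^esub> f"
            unfolding G_def using f x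
            by (intro group.m_inv_consistent[OF group_BijGroup subgroup_germ_stabilizer_Bij]) (auto simp: carrier_G)
          ultimately show ?thesis by simp
        qed
        then have "f' \<in> carrier G" using f by simp
        moreover have "f' y = y" if "y \<in> U" for y
          using inv[of y] f that UK by auto
        ultimately show "f' \<in> ?T" by blast
      qed
      then have "subgroup ?T G" unfolding G_def
        by (intro group.subgroup_incl[OF group_BijGroup _ subgroup_germ_stabilizer_Bij]) (auto simp: x)
      moreover have "S \<subseteq> ?T" using S(2) V by (auto simp: U_def)
      ultimately have "H \<subseteq> ?T" unfolding S(3) by (intro G.generate_subgroup_incl)
      then show ?thesis using h y by blast
    qed
    have H_bij: "h ` K = K" "inj_on h K" "h \<in> extensional K" "\<exists>g. homeomorphism K K h g" if "h \<in> H" for h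
      using homeo_groupD[OF G_homeo, of h] HG that by auto
    have D0K: "D 0 \<subseteq> K" by (rule clopenin_subset[OF clopen_D])
    \<comment> \<open>Outside \<open>D 0\<close> every \<open>h\<close> is the identity, so by
      injectivity it maps \<open>D 0\<close> onto itself.\<close>
    have H_D0: "h ` D 0 = D 0" if h: "h \<in> H" for h
    proof (intro equalityI subsetI)
      fix z assume "z \<in> h ` D 0"
      then obtain y where y: "y \<in> D 0" "z = h y" by blast
      have zK: "z \<in> K" using y D0K H_bij(1)[OF h] by blast
      show "z \<in> D 0"
      proof (rule ccontr)
        assume "z \<notin> D 0"
        then have "z \<in> U" using zK D0 by blast
        then have "h z = h y" using fixU[OF h] y by simp
        then have "z = y" using H_bij(2)[OF h] zK y D0K by (auto dest: inj_onD)
        then show False using y \<open>z \<notin> D 0\<close> by simp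
      qed
    next
      fix z assume z: "z \<in> D 0"
      then obtain y where y: "y \<in> K" "z = h y" using D0K H_bij(1)[OF h] by blast
      show "z \<in> h ` D 0"
      proof (cases "y \<in> D 0")
        case False
        then have "h y = y" using fixU[OF h] y D0 by blast
        then show ?thesis using False z y by simp
      qed (use y in blast)
    qed
    have homeo_D0: "\<exists>g. homeomorphism (D 0) (D 0) h g" if h: "h \<in> H" for h
      using H_bij(4)[OF h] homeomorphism_of_subsets[OF _ D0K D0K H_D0[OF h]] by blast
    define u where "u h i = (if (0::int) \<le> i then h else (\<lambda>y. y))" for h :: "'a \<Rightarrow> 'a" and i
    have u_D0: "u h i ` D 0 \<subseteq> D 0" if "h \<in> H" for h i
      using H_D0[OF that] by (auto simp: u_def)
    define \<phi> where "\<phi> h = restrict (paste (\<lambda>i. i) (u h)) K" for h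
    define \<gamma> where "\<gamma> = restrict (paste (\<lambda>i. i - 1) (\<lambda>i y. y)) K"
    have xW: "\<And>i. i \<in> {1..k} \<Longrightarrow> x i \<in> W" using W(2) by blast
    have id_D0: "homeomorphism (D 0) (D 0) (\<lambda>y. y) (\<lambda>y. y)" by (rule homeomorphism_ident)
    have \<gamma>G: "\<gamma> \<in> carrier G"
      unfolding carrier_G \<gamma>_def
      by (rule germ_memI[of "\<lambda>i. i + 1" _ _ W]) (use id_D0 W xW in auto)
    have \<phi>G: "\<phi> h \<in> carrier G" if h: "h \<in> H" for h
      unfolding carrier_G \<phi>_def
      by (rule germ_memI[of "\<lambda>i. i" _ _ W]) (use id_D0 homeo_D0[OF h] W xW in \<open>auto simp: u_def\<close>)
    have \<phi>K: "paste \<tau> (u h) y \<in> K" if "h \<in> H" "y \<in> K" for h y \<tau>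
      by (rule paste_K[OF u_D0[OF that(1)] that(2)])
    have \<phi>_hom: "\<phi> \<in> hom (G\<lparr>carrier := H\<rparr>) G"
      unfolding hom_def
    proof (intro CollectI conjI ballI funcsetI)
      show "\<phi> h \<in> carrier G" if "h \<in> carrier (G\<lparr>carrier := H\<rparr>)" for h using \<phi>G that by simp
      fix g h assume "g \<in> carrier (G\<lparr>carrier := H\<rparr>)" "h \<in> carrier (G\<lparr>carrier := H\<rparr>)"
      then have g: "g \<in> H" and h: "h \<in> H" by auto
      have "\<phi> (compose K g h) = compose K (\<phi> g) (\<phi> h)"
      proof
        fix y
        show "\<phi> (compose K g h) y = compose K (\<phi> g) (\<phi> h) y"
        proof (cases "y \<in> K")
          case True
          have "paste (\<lambda>i. i) (u (compose K g h)) y = paste (\<lambda>i. i) (\<lambda>i y. u g i (u h i y)) y"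
            by (rule paste_cong) (use D0K in \<open>auto simp: u_def compose_def\<close>)
          also have "\<dots> = paste (\<lambda>i. i) (u g) (paste (\<lambda>i. i) (u h) y)"
            by (rule paste_paste[OF u_D0[OF h], symmetric])
          finally show ?thesis using True \<phi>K[OF h True] by (simp add: \<phi>_def compose_def)
        qed (simp add: \<phi>_def compose_def)
      qed
      then show "\<phi> (g \<otimes>\<^bsub>G\<lparr>carrier := H\<rparr>\<^esub> h) = \<phi> g \<otimes>\<^bsub>G\<^esub> \<phi> h"
        using g h HG mult \<phi>G by (simp add: subset_iff)
    qed
    show "\<exists>\<phi>\<in>hom (G\<lparr>carrier := H\<rparr>) G. \<exists>\<gamma>\<in>carrier G. \<forall>h\<in>H.
        h = inv\<^bsub>G\<^esub> \<gamma> \<otimes>\<^bsub>G\<^esub> inv\<^bsub>G\<^esub> (\<phi> h) \<otimes>\<^bsub>G\<^esub> \<gamma> \<otimes>\<^bsub>G\<^esub> \<phi> h"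
    proof (rule bexI[OF _ \<phi>_hom], rule bexI[OF _ \<gamma>G], rule ballI)
      fix h assume h: "h \<in> H"
      have hG: "h \<in> carrier G" using HG h by blast
      \<comment> \<open>\<open>h\<close> itself as a pasted map: it acts in the block
        \<open>D 0\<close> only.\<close>
      let ?v = "\<lambda>i::int. if i = 0 then h else (\<lambda>y. y)"
      have v_D0: "?v i ` D 0 \<subseteq> D 0" for i using H_D0[OF h] by auto
      have h_paste: "h y = paste (\<lambda>i. i) ?v y" if y: "y \<in> K" for y
      proof (cases "\<exists>i. y \<in> D i")
        case True
        then obtain i where i: "y \<in> D i" ..
        show ?thesis
        proof (cases "i = 0")
          case True
          then have y0: "y \<in> D 0" using i by simp
          have "e' 0 y = y" using e'_e[OF y0, of 0] e_0[OF y0] by simp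
          moreover have "h y \<in> D 0" using H_D0[OF h] y0 by blast
          ultimately show ?thesis by (simp add: paste_in[OF y0] e_0)
        next
          case False
          then have "y \<notin> D 0" using disjoint_D[of i 0] i by blast
          then have "h y = y" using D0 y fixU[OF h] by blast
          then show ?thesis using False by (simp add: paste_in[OF i] e_e'[OF i])
        qed
      next
        case False
        then have "h y = y" using D0 y fixU[OF h] by blast
        then show ?thesis using False by (simp add: paste_out)
      qed
      \<comment> \<open>The commutator identity with inverses cleared; it can be checked block by
        block.\<close>
      have "\<phi> h \<otimes>\<^bsub>G\<^esub> (\<gamma> \<otimes>\<^bsub>G\<^esub> h) = \<gamma> \<otimes>\<^bsub>G\<^esub> \<phi> h"
      proof -
        have "compose K (\<phi> h) (compose K \<gamma> h) = compose K \<gamma> (\<phi> h)"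
        proof
          fix y
          show "compose K (\<phi> h) (compose K \<gamma> h) y = compose K \<gamma> (\<phi> h) y"
          proof (cases "y \<in> K")
            case True
            have hy: "h y \<in> K" using True H_bij(1)[OF h] by blast
            have ghy: "paste (\<lambda>i. i - 1) (\<lambda>i y. y) (h y) \<in> K"
              by (rule paste_K) (use hy in auto)
            have "compose K (\<phi> h) (compose K \<gamma> h) y
                = paste (\<lambda>i. i) (u h) (paste (\<lambda>i. i - 1) (\<lambda>i y. y) (paste (\<lambda>i. i) ?v y))"
              using True hy ghy h_paste[OF True] by (simp add: compose_def \<phi>_def \<gamma>_def)
            also have "\<dots> = paste (\<lambda>i. i) (u h) (paste (\<lambda>i. i - 1) ?v y)"
              by (subst paste_paste[OF v_D0]) simp
            also have "\<dots> = paste (\<lambda>i. i - 1) (\<lambda>i y. u h (i - 1) (?v i y)) y"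
              by (subst paste_paste[OF v_D0]) simp
            \<comment> \<open>The telescoping: on the block \<open>i\<close> the shifted map
              contributes \<open>h\<close> for \<open>i \<ge> 1\<close> and \<open>?v\<close>
              contributes it for \<open>i = 0\<close>, together exactly
              \<open>u h i\<close>.\<close>
            also have "\<dots> = paste (\<lambda>i. i - 1) (u h) y"
              by (rule paste_cong) (auto simp: u_def)
            also have "\<dots> = paste (\<lambda>i. i - 1) (\<lambda>i y. y) (paste (\<lambda>i. i) (u h) y)"
              by (subst paste_paste[OF u_D0[OF h]]) simp
            also have "\<dots> = compose K \<gamma> (\<phi> h) y"
              using True \<phi>K[OF h True] by (simp add: compose_def \<phi>_def \<gamma>_def)
            finally show ?thesis .
          qed (simp add: compose_def)
        qed
        moreover have "\<gamma> \<otimes>\<^bsub>G\<^esub> h = compose K \<gamma> h" by (rule mult[OF \<gamma>G hG])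
        moreover from this have "compose K \<gamma> h \<in> carrier G" using G.m_closed[OF \<gamma>G hG] by simp
        ultimately show ?thesis using mult \<phi>G[OF h] \<gamma>G by simp
      qed
      then have "\<gamma> \<otimes>\<^bsub>G\<^esub> h = inv\<^bsub>G\<^esub> (\<phi> h) \<otimes>\<^bsub>G\<^esub> (\<gamma> \<otimes>\<^bsub>G\<^esub> \<phi> h)"
        using \<phi>G[OF h] \<gamma>G hG by (metis G.inv_solve_left G.m_closed)
      then have "h = inv\<^bsub>G\<^esub> \<gamma> \<otimes>\<^bsub>G\<^esub> (inv\<^bsub>G\<^esub> (\<phi> h) \<otimes>\<^bsub>G\<^esub> (\<gamma> \<otimes>\<^bsub>G\<^esub> \<phi> h))"
        using \<phi>G[OF h] \<gamma>G hG by (metis G.inv_solve_left G.m_closed G.inv_closed)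
      then show "h = inv\<^bsub>G\<^esub> \<gamma> \<otimes>\<^bsub>G\<^esub> inv\<^bsub>G\<^esub> (\<phi> h) \<otimes>\<^bsub>G\<^esub> \<gamma> \<otimes>\<^bsub>G\<^esub> \<phi> h"
        using \<phi>G[OF h] \<gamma>G hG by (simp add: G.m_assoc)
    qed
  qed
  then show ?thesis by (simp add: germ_stabilizer_group_eq G_def)
qed

theorem corollary1p15:
  fixes K :: "'a::metric_space set" and k :: nat and x :: "nat \<Rightarrow> 'a"
  assumes "cantor_set K"
    and "k \<ge> 1"
    and "\<And>i. i \<in> {1..k} \<Longrightarrow> x i \<in> K"
  shows "subgroup (germ_stabilizer K k x) (homeo_group K)
    \<and> binate ((homeo_group K)\<lparr>carrier := germ_stabilizer K k x\<rparr>)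
    \<and> boundedly_acyclic ((homeo_group K)\<lparr>carrier := germ_stabilizer K k x\<rparr>)"
proof -
  let ?G = "(homeo_group K)\<lparr>carrier := germ_stabilizer K k x\<rparr>"
  have "subgroup (germ_stabilizer K k x) (homeo_group K)"
    by (rule subgroup_germ_stabilizer) (rule assms(3))
  moreover have bin: "binate ?G"
    by (rule binate_germ_stabilizer[OF assms])
  moreover have "group ?G" using bin by (simp add: binate_def)
  then have "boundedly_acyclic ?G"
    using bin by (rule group.binate_imp_boundedly_acyclic)
  ultimately show ?thesis by blast
qed

end
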